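(* Assume (A1)–(A5) of the context and let $(V^1,V^2)$ be the limit process described in the context (with the mean profiles $b_1,b_2$ given there, which vanish at $0$: the zero-start scaling regime). Then the functional correlation $$\varrho(t):=\frac{\mathrm{Cov}(V_t^1,V_t^2)}{\sqrt{\mathrm{Var}(V_t^1)\,\mathrm{Var}(V_t^2)}}$$ satisfies $\varrho(t)\sim C_\varrho\,t^{(3\alpha_1-\alpha_2)/2}$ as $t\downarrow0$, where $$C_\varrho=\frac{\gamma_{12}\nu_1^2\,b_\infty^{12}\|\psi^{12}\|_1\,\kappa_1^2\kappa_2\,\beta_1\,\mathrm{B}(\alpha_1,\alpha_2)\,\mathrm{B}(2\alpha_1+\alpha_2-1,\alpha_1+1)}{\sqrt{\nu_1^2\kappa_1^2\beta_1\mathrm{B}(2\alpha_1-1,\alpha_1+1)\;\nu_2^2\kappa_2^2\beta_2\mathrm{B}(2\alpha_2-1,\alpha_2+1)}},$$ with $\kappa_i=(\tilde\delta_i\Gamma(\alpha_i))^{-1}$, $\beta_i=\kappa_i/\alpha_i$ (constants), and $\mathrm B$ the Euler Beta function.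
   Context: Notation: $\widehat f(z)=\int_0^\infty e^{-zt}f(t)\,dt$, $*$ is convolution on $\mathbb{R}_+$, $\|\cdot\|_1$ is the $L^1(\mathbb{R}_+)$ norm. Assumptions. For $i\in\{1,2\}$: (A1) $\phi^i\ge0$, $\phi^i\in L^1(\mathbb{R}_+)\cap L^2(\mathbb{R}_+)$, $\|\phi^i\|_1=1$, and $1-\widehat{\phi^i}(z)=\delta_iz^{\alpha_i}+o(z^{\alpha_i})$ as $z\to0$, $\Re z\ge0$, for some $\alpha_i\in(1/2,1)$, $\delta_i>0$, with $\alpha_1<\alpha_2$. Each $\phi^i$ is strongly aperiodic, i.e. $\sup_{w\in\mathbb{R},|w|\ge\rho}|\widehat{\phi^i}(iw)|<1$ for all $\rho>0$, and absolutely continuous with $(\phi^i)'\in L^1(\mathbb{R}_+)$. (A2) $a_T^i\in(0,1)$, $a_T^i\uparrow1$ and $T^{\alpha_i}(1-a_T^i)\to\lambda_i\in(0,\infty)$ as $T\to\infty$. (A3) $\psi^{12}\ge0$, $\psi^{12}\in L^1(\mathbb{R}_+)\cap L^2(\mathbb{R}_+)$, $\phi_T^{12}=b_T^{12}\psi^{12}$ and $T^{2\alpha_1-\alpha_2}b_T^{12}\to b_\infty^{12}\in(0,\infty)$. (A4) The baselines $\mu_T^i>0$ satisfy $T^{1-\alpha_i}\mu_T^i\to m_i\in(0,\infty)$. (A5) $\lambda_1^{1/\alpha_1}=\lambda_2^{1/\alpha_2}=:\lambda^*$. Limit objects. $\tilde\delta_i=\delta_i/\lambda_i$; $K_i$ is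 the Mittag-Leffler kernel with $\widehat{K_i}(z)=(1+\tilde\delta_iz^{\alpha_i})^{-1}$; $\nu_i=(m_i\lambda_i)^{-1/2}$; $\gamma_{12}=m_1/(m_2\lambda_1)$; $L_{12}=b_\infty^{12}\|\psi^{12}\|_1(K_1*K_2)$; $b_1(t)=\int_0^tK_1(w)\,dw$; $b_2(t)=\int_0^tK_2(w)\,dw+\gamma_{12}\int_0^tL_{12}(w)\,dw$. Limit process. $(V^1,V^2)$ is the triangular weak solution (unique in law; it is the weak limit of the renormalized Hawkes intensities with parameters $\mu_T^i$, $a_T^i\phi^i$, $\phi_T^{12}$) of $V_t^1=b_1(t)+\nu_1\int_0^tK_1(t-s)\sqrt{V_s^1}\,dB_s^1$, $V_t^2=b_2(t)+\nu_2\int_0^tK_2(t-s)\sqrt{V_s^2}\,dB_s^2+\gamma_{12}\nu_1\int_0^tL_{12}(t-s)\sqrt{V_s^1}\,dB_s^1$, $t\in[0,1]$. A triangular weak solution consists of a standard stochastic basis with filtration $(\mathbb F_t)_{t\in[0,1]}$, continuous non-negative adapted processes $(V^1,V^2)$ with $\mathbb{E}[\sup_{t\le1}(V_t^1+V_t^2)]<\infty$, and $\mathbb F$-Brownian motions $B^1,B^2$ satisfying both equations almost surely, such that $B^2$ is a Brownian motion with respect to the enlarged filtration $\sigma(V_s^1,B_s^1:0\le s\le1)\vee\mathbb F_t$. *)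

theory Defs
  imports
    "HOL-Probability.Probability"
    "HOL-Complex_Analysis.Complex_Analysis"
    "HOL-Library.Landau_Symbols"
begin

section \<open>Functions on the half line\<close>

text \<open>A function on \<open>[0,\<infinity>)\<close> is represented by a function on all of \<open>real\<close> whose values at
  negative arguments are never inspected.\<close>

definition in_L1 :: "(real \<Rightarrow> real) \<Rightarrow> bool" where
  "in_L1 f \<longleftrightarrow> set_integrable lborel {0..} f"

definition in_L2 :: "(real \<Rightarrow> real) \<Rightarrow> bool" where
  "in_L2 f \<longleftrightarrow> set_borel_measurable lborel {0..} f \<and> set_integrable lborel {0..} (\<lambda>t. (f t)\<^sup>2)"

definition norm_L1 :: "(real \<Rightarrow> real) \<Rightarrow> real" where
  "norm_L1 f = (LINT t:{0..}|lborel. \<bar>f t\<bar>)"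

definition laplace :: "(real \<Rightarrow> real) \<Rightarrow> complex \<Rightarrow> complex" where
  "laplace f z = (LINT t:{0..}|lborel. exp (- z * complex_of_real t) * complex_of_real (f t))"

definition conv :: "(real \<Rightarrow> real) \<Rightarrow> (real \<Rightarrow> real) \<Rightarrow> real \<Rightarrow> real" where
  "conv f g t = (LINT s:{0..t}|lborel. f (t - s) * g s)"

definition abs_continuous_on :: "real set \<Rightarrow> (real \<Rightarrow> real) \<Rightarrow> bool" where
  "abs_continuous_on S f \<longleftrightarrow>
     (\<forall>\<epsilon>>0. \<exists>\<eta>>0. \<forall>(n::nat) u v.
        (\<forall>i<n. u i \<le> v i \<and> {u i..v i} \<subseteq> S) \<longrightarrow>
        disjoint_family_on (\<lambda>i. {u i<..<v i}) {..<n} \<longrightarrow>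
        (\<Sum>i<n. v i - u i) < \<eta> \<longrightarrow> (\<Sum>i<n. \<bar>f (v i) - f (u i)\<bar>) < \<epsilon>)"

definition strongly_aperiodic :: "(real \<Rightarrow> real) \<Rightarrow> bool" where
  "strongly_aperiodic \<phi> \<longleftrightarrow>
     (\<forall>\<rho>>0. (SUP w\<in>{w::real. \<rho> \<le> \<bar>w\<bar>}. cmod (laplace \<phi> (\<i> * complex_of_real w))) < 1)"

text \<open>The Laplace transform determines the kernel up to a null set, and only that equivalence
  class enters below.  No representative is fixed.\<close>

definition mittag_leffler_kernel :: "real \<Rightarrow> real \<Rightarrow> (real \<Rightarrow> real) \<Rightarrow> bool" where
  "mittag_leffler_kernel \<alpha> d K \<longleftrightarrow>
     in_L1 K \<and>
     (\<forall>z. Re z \<ge> 0 \<longrightarrow> laplace K z = inverse (1 + complex_of_real d * z powr complex_of_real \<alpha>))"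


section \<open>Assumptions on the Hawkes parameters\<close>

text \<open>The derivative of an absolutely continuous function exists only almost everywhere and
  \<open>deriv\<close> is arbitrary elsewhere; integrability is therefore stated over the completed
  measure \<open>lebesgue\<close>, which does not see these values.\<close>

definition assm_A1 :: "(real \<Rightarrow> real) \<Rightarrow> real \<Rightarrow> real \<Rightarrow> bool" where
  "assm_A1 \<phi> \<alpha> \<delta> \<longleftrightarrow>
     (\<forall>t\<ge>0. 0 \<le> \<phi> t) \<and> in_L1 \<phi> \<and> in_L2 \<phi> \<and> norm_L1 \<phi> = 1 \<and>
     1/2 < \<alpha> \<and> \<alpha> < 1 \<and> 0 < \<delta> \<and>
     (\<lambda>z. 1 - laplace \<phi> z - complex_of_real \<delta> * z powr complex_of_real \<alpha>)
        \<in> o[at 0 within {z. Re z \<ge> 0}](\<lambda>z. z powr complex_of_real \<alpha>) \<and>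
     strongly_aperiodic \<phi> \<and>
     (\<forall>R>0. abs_continuous_on {0..R} \<phi>) \<and> set_integrable lebesgue {0<..} (deriv \<phi>)"

definition assm_A2 :: "(real \<Rightarrow> real) \<Rightarrow> real \<Rightarrow> real \<Rightarrow> bool" where
  "assm_A2 a \<alpha> lam \<longleftrightarrow>
     (\<forall>T>0. 0 < a T \<and> a T < 1) \<and> mono_on {0<..} a \<and> (a \<longlongrightarrow> 1) at_top \<and>
     0 < lam \<and> ((\<lambda>T. T powr \<alpha> * (1 - a T)) \<longlongrightarrow> lam) at_top"

definition assm_A3 ::
  "(real \<Rightarrow> real) \<Rightarrow> (real \<Rightarrow> real) \<Rightarrow> (real \<Rightarrow> real \<Rightarrow> real) \<Rightarrow> real \<Rightarrow> real \<Rightarrow> real \<Rightarrow> bool" where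
  "assm_A3 \<psi> b \<phi> \<alpha>1 \<alpha>2 binf \<longleftrightarrow>
     (\<forall>t\<ge>0. 0 \<le> \<psi> t) \<and> in_L1 \<psi> \<and> in_L2 \<psi> \<and>
     (\<forall>T>0. \<forall>t\<ge>0. \<phi> T t = b T * \<psi> t) \<and>
     0 < binf \<and> ((\<lambda>T. T powr (2 * \<alpha>1 - \<alpha>2) * b T) \<longlongrightarrow> binf) at_top"

definition assm_A4 :: "(real \<Rightarrow> real) \<Rightarrow> real \<Rightarrow> real \<Rightarrow> bool" where
  "assm_A4 \<mu> \<alpha> m \<longleftrightarrow>
     (\<forall>T>0. 0 < \<mu> T) \<and> 0 < m \<and> ((\<lambda>T. T powr (1 - \<alpha>) * \<mu> T) \<longlongrightarrow> m) at_top"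


section \<open>Stochastic basis, Brownian motion and the Ito integral on [0,1]\<close>

text \<open>Filtrations are families \<open>real \<Rightarrow> 'a measure\<close> of which only the members with index in
  \<open>[0,1]\<close> and only their \<open>\<sigma>\<close>-algebras are used.\<close>

definition filtration01 :: "'a measure \<Rightarrow> (real \<Rightarrow> 'a measure) \<Rightarrow> bool" where
  "filtration01 M F \<longleftrightarrow>
     (\<forall>t\<in>{0..1}. subalgebra M (F t)) \<and>
     (\<forall>s\<in>{0..1}. \<forall>t\<in>{0..1}. s \<le> t \<longrightarrow> sets (F s) \<subseteq> sets (F t))"

text \<open>The usual conditions: completeness and right continuity.\<close>

definition standard_stochastic_basis :: "'a measure \<Rightarrow> (real \<Rightarrow> 'a measure) \<Rightarrow> bool" where
  "standard_stochastic_basis M F \<longleftrightarrow>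
     prob_space M \<and> complete_measure M \<and> filtration01 M F \<and> null_sets M \<subseteq> sets (F 0) \<and>
     (\<forall>t\<in>{0..<1}. sets (F t) = (\<Inter>s\<in>{t<..1}. sets (F s)))"

definition brownian_motion01 ::
  "'a measure \<Rightarrow> (real \<Rightarrow> 'a measure) \<Rightarrow> (real \<Rightarrow> 'a \<Rightarrow> real) \<Rightarrow> bool" where
  "brownian_motion01 M F B \<longleftrightarrow>
     filtration01 M F \<and>
     (\<forall>t\<in>{0..1}. B t \<in> borel_measurable (F t)) \<and>
     (AE \<omega> in M. B 0 \<omega> = 0) \<and>
     (AE \<omega> in M. continuous_on {0..1} (\<lambda>t. B t \<omega>)) \<and>
     (\<forall>s\<in>{0..1}. \<forall>t\<in>{0..1}. s < t \<longrightarrow>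
        distributed M lborel (\<lambda>\<omega>. B t \<omega> - B s \<omega>) (normal_density 0 (sqrt (t - s))) \<and>
        prob_space.indep_set M (sets (F s))
          (sets (vimage_algebra (space M) (\<lambda>\<omega>. B t \<omega> - B s \<omega>) borel)))"

text \<open>A simple integrand on \<open>[0,t]\<close> is
  \<open>\<xi>\<^sub>0 1\<^bsub>(\<tau>\<^sub>0,\<tau>\<^sub>1]\<^esub> + \<dots> + \<xi>\<^bsub>n-1\<^esub> 1\<^bsub>(\<tau>\<^bsub>n-1\<^esub>,\<tau>\<^sub>n]\<^esub>\<close>
  with deterministic \<open>\<tau>\<^sub>0 \<le> \<dots> \<le> \<tau>\<^sub>n\<close> and bounded \<open>\<xi>\<^sub>i\<close> that are measurable at time \<open>\<tau>\<^sub>i\<close>.\<close>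

definition simple_integrand ::
  "(real \<Rightarrow> 'a measure) \<Rightarrow> real \<Rightarrow> nat \<Rightarrow> (nat \<Rightarrow> real) \<Rightarrow> (nat \<Rightarrow> 'a \<Rightarrow> real) \<Rightarrow> bool" where
  "simple_integrand F t n \<tau> \<xi> \<longleftrightarrow>
     (\<forall>i\<le>n. \<tau> i \<in> {0..t}) \<and> (\<forall>i<n. \<tau> i \<le> \<tau> (Suc i)) \<and>
     (\<forall>i<n. \<xi> i \<in> borel_measurable (F (\<tau> i)) \<and> (\<exists>C. \<forall>\<omega>\<in>space (F (\<tau> i)). \<bar>\<xi> i \<omega>\<bar> \<le> C))"

definition simple_value ::
  "nat \<Rightarrow> (nat \<Rightarrow> real) \<Rightarrow> (nat \<Rightarrow> 'a \<Rightarrow> real) \<Rightarrow> real \<Rightarrow> 'a \<Rightarrow> real" where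
  "simple_value n \<tau> \<xi> s \<omega> = (\<Sum>i<n. \<xi> i \<omega> * indicator {\<tau> i<..\<tau> (Suc i)} s)"

definition simple_integral ::
  "(real \<Rightarrow> 'a \<Rightarrow> real) \<Rightarrow> nat \<Rightarrow> (nat \<Rightarrow> real) \<Rightarrow> (nat \<Rightarrow> 'a \<Rightarrow> real) \<Rightarrow> 'a \<Rightarrow> real" where
  "simple_integral B n \<tau> \<xi> \<omega> = (\<Sum>i<n. \<xi> i \<omega> * (B (\<tau> (Suc i)) \<omega> - B (\<tau> i) \<omega>))"

text \<open>\<open>has_ito_integral M F B t H X\<close>: the random variable \<open>X\<close> is (a version of) the Ito integral
  of \<open>H\<close> with respect to \<open>B\<close> over \<open>[0,t]\<close>, in the square-integrable theory: \<open>X\<close> is the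
  mean-square limit of the integrals of simple integrands that converge to \<open>H\<close> in
  \<open>L\<^sup>2([0,t] \<times> M)\<close>.\<close>

definition has_ito_integral ::
  "'a measure \<Rightarrow> (real \<Rightarrow> 'a measure) \<Rightarrow> (real \<Rightarrow> 'a \<Rightarrow> real) \<Rightarrow> real \<Rightarrow>
   (real \<Rightarrow> 'a \<Rightarrow> real) \<Rightarrow> ('a \<Rightarrow> real) \<Rightarrow> bool" where
  "has_ito_integral M F B t H X \<longleftrightarrow>
     X \<in> borel_measurable M \<and>
     (\<lambda>(s, \<omega>). indicator {0..t} s * H s \<omega>) \<in> borel_measurable (lborel \<Otimes>\<^sub>M M) \<and>
     (\<exists>n \<tau> \<xi>.
        (\<forall>k::nat. simple_integrand F t (n k) (\<tau> k) (\<xi> k)) \<and>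
        (\<lambda>k. \<integral>\<^sup>+\<omega>. (\<integral>\<^sup>+s\<in>{0..t}. ennreal ((H s \<omega> - simple_value (n k) (\<tau> k) (\<xi> k) s \<omega>)\<^sup>2) \<partial>lborel) \<partial>M)
           \<longlonglongrightarrow> 0 \<and>
        (\<lambda>k. \<integral>\<^sup>+\<omega>. ennreal ((X \<omega> - simple_integral B (n k) (\<tau> k) (\<xi> k) \<omega>)\<^sup>2) \<partial>M)
           \<longlonglongrightarrow> 0)"


section \<open>Triangular weak solutions\<close>

definition enlarged_filtration ::
  "'a measure \<Rightarrow> (real \<Rightarrow> 'a measure) \<Rightarrow> (real \<Rightarrow> 'a \<Rightarrow> real) \<Rightarrow> (real \<Rightarrow> 'a \<Rightarrow> real) \<Rightarrow>
   real \<Rightarrow> 'a measure" where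
  "enlarged_filtration M F V B t =
     sigma (space M)
       ((\<Union>s\<in>{0..1}. sets (vimage_algebra (space M) (V s) borel)
                    \<union> sets (vimage_algebra (space M) (B s) borel)) \<union> sets (F t))"

text \<open>The integrand \<open>K (t - s) * sqrt (V s)\<close> depends on \<open>t\<close>, so each stochastic integral is
  determined up to a null set for each fixed \<open>t\<close>; accordingly the two equations hold almost
  surely for every \<open>t\<close>.\<close>

definition triangular_weak_solution ::
  "(real \<Rightarrow> real) \<Rightarrow> (real \<Rightarrow> real) \<Rightarrow> (real \<Rightarrow> real) \<Rightarrow> (real \<Rightarrow> real) \<Rightarrow> (real \<Rightarrow> real) \<Rightarrow>
   real \<Rightarrow> real \<Rightarrow> real \<Rightarrow>
   'a measure \<Rightarrow> (real \<Rightarrow> 'a measure) \<Rightarrow>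
   (real \<Rightarrow> 'a \<Rightarrow> real) \<Rightarrow> (real \<Rightarrow> 'a \<Rightarrow> real) \<Rightarrow>
   (real \<Rightarrow> 'a \<Rightarrow> real) \<Rightarrow> (real \<Rightarrow> 'a \<Rightarrow> real) \<Rightarrow> bool" where
  "triangular_weak_solution b1 b2 K1 K2 L12 \<nu>1 \<nu>2 \<gamma>12 M F V1 V2 B1 B2 \<longleftrightarrow>
     standard_stochastic_basis M F \<and>
     (\<forall>V\<in>{V1, V2}.
        (\<forall>t\<in>{0..1}. V t \<in> borel_measurable (F t)) \<and>
        (\<forall>\<omega>\<in>space M. continuous_on {0..1} (\<lambda>t. V t \<omega>) \<and> (\<forall>t\<in>{0..1}. 0 \<le> V t \<omega>))) \<and>
     (\<integral>\<^sup>+\<omega>. (SUP t\<in>{0..1}. ennreal (V1 t \<omega> + V2 t \<omega>)) \<partial>M) < \<infinity> \<and>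
     brownian_motion01 M F B1 \<and> brownian_motion01 M F B2 \<and>
     (\<forall>t\<in>{0..1}. \<exists>I.
        has_ito_integral M F B1 t (\<lambda>s \<omega>. K1 (t - s) * sqrt (V1 s \<omega>)) I \<and>
        (AE \<omega> in M. V1 t \<omega> = b1 t + \<nu>1 * I \<omega>)) \<and>
     (\<forall>t\<in>{0..1}. \<exists>I J.
        has_ito_integral M F B2 t (\<lambda>s \<omega>. K2 (t - s) * sqrt (V2 s \<omega>)) I \<and>
        has_ito_integral M F B1 t (\<lambda>s \<omega>. L12 (t - s) * sqrt (V1 s \<omega>)) J \<and>
        (AE \<omega> in M. V2 t \<omega> = b2 t + \<nu>2 * I \<omega> + \<gamma>12 * \<nu>1 * J \<omega>)) \<and>
     brownian_motion01 M (enlarged_filtration M F V1 B1) B2"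


section \<open>Functional correlation\<close>

definition covariance :: "'a measure \<Rightarrow> ('a \<Rightarrow> real) \<Rightarrow> ('a \<Rightarrow> real) \<Rightarrow> real" where
  "covariance M X Y =
     (\<integral>\<omega>. (X \<omega> - (\<integral>\<omega>. X \<omega> \<partial>M)) * (Y \<omega> - (\<integral>\<omega>. Y \<omega> \<partial>M)) \<partial>M)"

definition functional_correlation ::
  "'a measure \<Rightarrow> (real \<Rightarrow> 'a \<Rightarrow> real) \<Rightarrow> (real \<Rightarrow> 'a \<Rightarrow> real) \<Rightarrow> real \<Rightarrow> real" where
  "functional_correlation M V1 V2 t =
     covariance M (V1 t) (V2 t) /
       sqrt (prob_space.variance M (V1 t) * prob_space.variance M (V2 t))"

end

theory Submission
  imports Defs
begin

text \<open>
  Both coordinates of the limit process are a deterministic mean plus Ito integrals whose integrands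
  are a Volterra kernel times the square root of a coordinate, so their second moments are explicit.  The stochastic integrals are centred,
  hence \<open>V1\<close> and \<open>V2\<close> have means \<open>b1\<close> and \<open>b2\<close>, and the Ito isometry turns
  every product of two integrals against \<open>B1\<close> with integrands \<open>K (t - s) * sqrt (V s)\<close> and
  \<open>L (t - s) * sqrt (V s)\<close> into the convolution of \<open>K * L\<close> with the mean of \<open>V\<close>.
  The integral against \<open>B2\<close> is orthogonal to the integrals against \<open>B1\<close>, because \<open>B2\<close> stays a
  Brownian motion when the whole path of \<open>B1\<close> is added to the filtration.  This gives
  (\<open>triangular_weak_solution_covariance\<close> and its two companions)

  \<^item> \<open>Cov (V1 t, V2 t) = \<gamma>12 * \<nu>1\<^sup>2 * ((K1 * L12) \<star> b1) t\<close>,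
  \<^item> \<open>Var (V1 t) = \<nu>1\<^sup>2 * (K1\<^sup>2 \<star> b1) t\<close>,
  \<^item> \<open>Var (V2 t) = \<nu>2\<^sup>2 * (K2\<^sup>2 \<star> b2) t + (\<gamma>12 * \<nu>1)\<^sup>2 * (L12\<^sup>2 \<star> b1) t\<close>,

  where \<open>\<star>\<close> is convolution.  What remains is the behaviour of these convolutions at \<open>0\<close>.

  The kernels are known only through their Laplace transforms, hence only almost everywhere.  With
  \<open>x = z powr (- \<alpha>)\<close> the transform is \<open>x / (x + d)\<close>, and
  \<open>d\<^sup>2 * x / (x + d) = d * x - x\<^sup>2 + x\<^sup>2 * (x / (x + d))\<close>.  Powers of \<open>x\<close> are
  transforms of power functions, so by uniqueness of Laplace transforms
  \<open>d\<^sup>2 * K u\<close> equals \<open>d * u powr (\<alpha> - 1) / Gamma \<alpha>\<close> up to multiples of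
  \<open>u powr (2 * \<alpha> - 1)\<close> and of the convolution of that power with \<open>K\<close>.  Since \<open>\<alpha> > 1 / 2\<close> the
  exponent \<open>2 * \<alpha> - 1\<close> is positive, integrability of \<open>K\<close> bounds that convolution, and
  \<open>K u\<close> behaves like \<open>\<kappa> * u powr (\<alpha> - 1)\<close> at the origin
  (\<open>mittag_leffler_kernel_near_0\<close>).

  Power behaviour at the origin is stable under products (exponents \<open>p - 1\<close> and \<open>q - 1\<close> add up)
  and under convolution, where the constant picks up the factor \<open>Beta p q\<close>
  (\<open>ae_power_near_0_mult\<close>, \<open>conv_power_limit\<close>).  Applied to the three formulas above this yields
  orders \<open>3 * \<alpha>1 + \<alpha>2 - 1\<close>, \<open>3 * \<alpha>1 - 1\<close> and \<open>3 * \<alpha>2 - 1\<close>; the second summand of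
  \<open>Var (V2 t)\<close> has the higher order \<open>3 * \<alpha>1 + 2 * \<alpha>2 - 1\<close>, as \<open>3 * \<alpha>1 > \<alpha>2\<close>, and drops
  out.  Dividing gives the exponent \<open>(3 * \<alpha>1 - \<alpha>2) / 2\<close> and the constant \<open>C\<close>.
\<close>

section \<open>Power behaviour at the origin under products and convolutions\<close>

text \<open>The exponent is written \<open>p - 1\<close> so that \<open>p\<close> is the parameter of the Beta and Gamma integrals,
  and the estimate is required almost everywhere because kernels are fixed only up to null sets.
  The coefficient \<open>A\<close> may be \<open>0\<close>, which means \<open>f u = o(u powr (p - 1))\<close>.\<close>

definition ae_power_near_0 :: "(real \<Rightarrow> real) \<Rightarrow> real \<Rightarrow> real \<Rightarrow> bool" where
  "ae_power_near_0 f A p \<longleftrightarrow> set_borel_measurable lborel {0..} f \<and>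
     (\<forall>\<epsilon>>0. \<exists>\<eta>>0. AE u in lborel. 0 < u \<and> u < \<eta> \<longrightarrow>
        \<bar>f u - A * u powr (p - 1)\<bar> \<le> \<epsilon> * u powr (p - 1))"

text \<open>The Beta integral rescaled by \<open>s = t * x\<close>: this is the convolution of two pure powers.\<close>

lemma has_bochner_integral_Beta_interval:
  fixes p q t :: real
  assumes "p > 0" "q > 0" "t > 0"
  shows "has_bochner_integral lborel
           (\<lambda>s. indicator {0..t} s * ((t - s) powr (p - 1) * s powr (q - 1)))
           (Beta p q * t powr (p + q - 1))"
proof -
  have "((\<lambda>x. x powr (q - 1) * (1 - x) powr (p - 1)) has_integral Beta q p) {0..1}"
    by (rule has_integral_Beta_real) (use assms in auto)
  with set_borel_integral_eq_integral(2)[OF integrable_Beta[OF assms(2,1)]]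
  have "(LINT x:{0..1}|lborel. x powr (q - 1) * (1 - x) powr (p - 1)) = Beta p q"
    by (auto simp: integral_unique Beta_commute)
  with integrable_Beta[OF assms(2,1)]
  have *: "has_bochner_integral lborel
      (\<lambda>x. indicator {0..1} x * (x powr (q - 1) * (1 - x) powr (p - 1))) (Beta p q)"
    by (simp add: has_bochner_integral_iff set_integrable_def set_lebesgue_integral_def)
  have eq: "t powr (p + q - 2) * (indicator {0..1} x * (x powr (q - 1) * (1 - x) powr (p - 1)))
      = indicator {0..t} (0 + t * x) *
          ((t - (0 + t * x)) powr (p - 1) * (0 + t * x) powr (q - 1))" for x
  proof (cases "x \<in> {0..1}")
    case True
    have "t - t * x = t * (1 - x)" by (simp add: algebra_simps)
    moreover have "t * x \<le> t" using True assms by simp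
    moreover have "t powr (p + q - 2) = t powr (p - 1) * t powr (q - 1)"
      by (simp add: powr_add[symmetric])
    ultimately show ?thesis using True assms by (simp add: powr_mult)
  next
    case False
    have "t * x \<notin> {0..t}"
      using False assms by (auto simp: zero_le_mult_iff)
    then show ?thesis using False by simp
  qed
  have pw: "t powr (p + q - 2) * Beta p q = (Beta p q * t powr (p + q - 1)) /\<^sub>R \<bar>t\<bar>"
  proof -
    have "t powr (p + q - 1) = t powr (p + q - 2) * t powr 1"
      by (subst powr_add[symmetric]) simp
    then show ?thesis using assms by simp
  qed
  have "has_bochner_integral lborel
      (\<lambda>x. t powr (p + q - 2) * (indicator {0..1} x * (x powr (q - 1) * (1 - x) powr (p - 1))))
      (t powr (p + q - 2) * Beta p q)"
    using has_bochner_integral_mult_right[OF *] by simp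
  then show ?thesis
    unfolding eq pw
    by (subst lborel_has_bochner_integral_real_affine_iff[where c = t and t = 0]) (use assms in auto)
qed

text \<open>Measurability is available only for the functions cut off at \<open>0\<close>; the domain of integration
  makes the cut-offs invisible.\<close>

lemma conv_restrict_half_line:
  "conv f g t = (\<integral>s. indicator {0..t} s * ((indicator {0..} (t - s) * f (t - s)) * (indicator {0..} s * g s)) \<partial>lborel)"
  unfolding conv_def set_lebesgue_integral_def
  by (rule Bochner_Integration.integral_cong) (auto simp: indicator_def)

lemma conv_measurable:
  assumes "set_borel_measurable lborel {0..} f" "set_borel_measurable lborel {0..} g"
  shows "conv f g \<in> borel_measurable borel"
proof -
  have [measurable]: "(\<lambda>x. indicator {0..} x * f x) \<in> borel_measurable borel"
    "(\<lambda>x. indicator {0..} x * g x) \<in> borel_measurable borel"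
    using assms by (auto simp: set_borel_measurable_def)
  have f[measurable]: "(\<lambda>(t, s). indicator {0..} (t - s) * f (t - s)) \<in> borel_measurable (borel \<Otimes>\<^sub>M (lborel :: real measure))"
    by (subst measurable_split_conv, rule measurable_compose[of _ _ borel "\<lambda>x. indicator {0..} x * f x"]) auto
  have "(\<lambda>x. indicator {0..} (snd x :: real) * indicator {0..} (fst x - snd x) :: real) \<in> borel_measurable (borel \<Otimes>\<^sub>M (lborel :: real measure))"
    by measurable
  also have "(\<lambda>x. indicator {0..} (snd x :: real) * indicator {0..} (fst x - snd x) :: real) = (\<lambda>(t, s). indicator {0..t} s)"
    by (auto simp: indicator_def fun_eq_iff)
  finally have i[measurable]: "(\<lambda>(t, s). indicator {0..t} s :: real) \<in> borel_measurable (borel \<Otimes>\<^sub>M (lborel :: real measure))" .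
  show ?thesis
    unfolding conv_restrict_half_line[abs_def]
    by (rule lborel.borel_measurable_lebesgue_integral) measurable
qed

lemma small_multiplier_exists:
  fixes \<epsilon> c :: real
  assumes "\<epsilon> > 0" "c > 0"
  shows "\<exists>e>0. e \<le> 1 \<and> e * c < \<epsilon>"
proof (intro exI conjI)
  have "min 1 (\<epsilon> / (2 * c)) * c \<le> \<epsilon> / (2 * c) * c"
    using assms by (intro mult_right_mono) auto
  also have "\<dots> < \<epsilon>" using assms by simp
  finally show "min 1 (\<epsilon> / (2 * c)) * c < \<epsilon>" .
qed (use assms in auto)

lemma ae_power_near_0_mult:
  assumes f: "ae_power_near_0 f A p" and g: "ae_power_near_0 g B q"
  shows "ae_power_near_0 (\<lambda>u. f u * g u) (A * B) (p + q - 1)"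
  unfolding ae_power_near_0_def
proof (intro conjI allI impI)
  have "(\<lambda>x. (indicator {0..} x * f x) * (indicator {0..} x * g x)) \<in> borel_measurable lborel"
    using f g by (intro borel_measurable_times[of "\<lambda>x. indicator {0..} x * f x"]) (auto simp: ae_power_near_0_def set_borel_measurable_def)
  also have "(\<lambda>x. (indicator {0..} x * f x) * (indicator {0..} x * g x)) = (\<lambda>x. indicator {0..} x * (f x * g x))"
    by (auto simp: indicator_def)
  finally show "set_borel_measurable lborel {0..} (\<lambda>u. f u * g u)"
    by (simp add: set_borel_measurable_def)
next
  fix \<epsilon> :: real assume "\<epsilon> > 0"
  obtain e where e: "e > 0" "e \<le> 1" "e * (\<bar>A\<bar> + \<bar>B\<bar> + 1) < \<epsilon>"
    using small_multiplier_exists[OF \<open>\<epsilon> > 0\<close>, of "\<bar>A\<bar> + \<bar>B\<bar> + 1"] by force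
  obtain \<eta>1 where 1: "\<eta>1 > 0" "AE u in lborel. 0 < u \<and> u < \<eta>1 \<longrightarrow>
        \<bar>f u - A * u powr (p - 1)\<bar> \<le> e * u powr (p - 1)"
    using f e unfolding ae_power_near_0_def by blast
  obtain \<eta>2 where 2: "\<eta>2 > 0" "AE u in lborel. 0 < u \<and> u < \<eta>2 \<longrightarrow>
        \<bar>g u - B * u powr (q - 1)\<bar> \<le> e * u powr (q - 1)"
    using g e unfolding ae_power_near_0_def by blast
  have "AE u in lborel. 0 < u \<and> u < min \<eta>1 \<eta>2 \<longrightarrow>
        \<bar>f u * g u - A * B * u powr (p + q - 1 - 1)\<bar> \<le> \<epsilon> * u powr (p + q - 1 - 1)"
    using 1(2) 2(2)
  proof eventually_elim
    case (elim u)
    show ?case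
    proof
      assume u: "0 < u \<and> u < min \<eta>1 \<eta>2"
      let ?x = "u powr (p - 1)" and ?y = "u powr (q - 1)"
      have xy: "u powr (p + q - 1 - 1) = ?x * ?y"
        by (simp add: powr_add[symmetric] algebra_simps)
      note xy = xy[unfolded diff_diff_eq one_add_one]
      have F: "\<bar>f u - A * ?x\<bar> \<le> e * ?x" and G: "\<bar>g u - B * ?y\<bar> \<le> e * ?y"
        using elim u by auto
      have "\<bar>g u\<bar> \<le> (e + \<bar>B\<bar>) * ?y"
      proof -
        have "\<bar>g u\<bar> \<le> \<bar>g u - B * ?y\<bar> + \<bar>B * ?y\<bar>" by linarith
        also have "\<dots> \<le> e * ?y + \<bar>B\<bar> * ?y" using G by (simp add: abs_mult)
        finally show ?thesis by (simp add: algebra_simps)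
      qed
      then have "\<bar>g u\<bar> \<le> (1 + \<bar>B\<bar>) * ?y"
        using e(2) by (smt (verit) mult_right_mono powr_ge_zero)
      have "f u * g u - A * B * (?x * ?y) = (f u - A * ?x) * g u + A * ?x * (g u - B * ?y)"
        by (simp add: algebra_simps)
      also have "\<bar>\<dots>\<bar> \<le> \<bar>f u - A * ?x\<bar> * \<bar>g u\<bar> + \<bar>A\<bar> * ?x * \<bar>g u - B * ?y\<bar>"
        by (rule order_trans[OF abs_triangle_ineq]) (simp add: abs_mult)
      also have "\<dots> \<le> (e * ?x) * ((1 + \<bar>B\<bar>) * ?y) + \<bar>A\<bar> * ?x * (e * ?y)"
        using F G \<open>\<bar>g u\<bar> \<le> (1 + \<bar>B\<bar>) * ?y\<close> e by (intro add_mono mult_mono) auto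
      also have "\<dots> = (e * (\<bar>A\<bar> + \<bar>B\<bar> + 1)) * (?x * ?y)" by (simp add: algebra_simps)
      also have "\<dots> \<le> \<epsilon> * (?x * ?y)" using e by (intro mult_right_mono) auto
      finally show "\<bar>f u * g u - A * B * u powr (p + q - 1 - 1)\<bar> \<le> \<epsilon> * u powr (p + q - 1 - 1)"
        unfolding diff_diff_eq one_add_one xy .
    qed
  qed
  then show "\<exists>\<eta>>0. AE u in lborel. 0 < u \<and> u < \<eta> \<longrightarrow>
        \<bar>f u * g u - A * B * u powr (p + q - 1 - 1)\<bar> \<le> \<epsilon> * u powr (p + q - 1 - 1)"
    using 1(1) 2(1) by (intro exI[of _ "min \<eta>1 \<eta>2"]) auto
qed

text \<open>On \<open>{0..t}\<close> with \<open>t\<close> small both arguments \<open>t - s\<close> and \<open>s\<close> lie in the range where the power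
  estimates hold, so the integrand differs from \<open>A * B\<close> times the Beta integrand by a small multiple
  of the Beta integrand.  Although \<open>f\<close> and \<open>g\<close> are controlled only almost everywhere, the conclusion
  holds for every small \<open>t\<close>.\<close>

lemma conv_power_limit:
  assumes f: "ae_power_near_0 f A p" and g: "ae_power_near_0 g B q" and p: "p > 0" and q: "q > 0"
  shows "((\<lambda>t. conv f g t / t powr (p + q - 1)) \<longlongrightarrow> A * B * Beta p q) (at_right 0)"
proof (rule tendstoI)
  fix \<epsilon> :: real assume "\<epsilon> > 0"
  have Bpos: "Beta p q > 0" using p q by (simp add: Beta_def)
  have "(\<bar>A\<bar> + \<bar>B\<bar> + 1) * Beta p q > 0" using Bpos by (intro mult_pos_pos) auto
  then obtain e where e: "e > 0" "e \<le> 1" and e3: "e * ((\<bar>A\<bar> + \<bar>B\<bar> + 1) * Beta p q) < \<epsilon>"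
    using small_multiplier_exists[OF \<open>\<epsilon> > 0\<close>] by blast
  let ?f = "\<lambda>x. indicator {0..} x * f x" and ?g = "\<lambda>x. indicator {0..} x * g x"
  have [measurable]: "?f \<in> borel_measurable borel" "?g \<in> borel_measurable borel"
    using f g by (auto simp: ae_power_near_0_def set_borel_measurable_def)
  obtain \<eta>1 where 1: "\<eta>1 > 0" "AE u in lborel. 0 < u \<and> u < \<eta>1 \<longrightarrow>
        \<bar>f u - A * u powr (p - 1)\<bar> \<le> e * u powr (p - 1)"
    using f e unfolding ae_power_near_0_def by blast
  obtain \<eta>2 where 2: "\<eta>2 > 0" "AE u in lborel. 0 < u \<and> u < \<eta>2 \<longrightarrow>
        \<bar>g u - B * u powr (q - 1)\<bar> \<le> e * u powr (q - 1)"
    using g e unfolding ae_power_near_0_def by blast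
  have bd1: "AE u in lborel. 0 < u \<and> u < \<eta>1 \<longrightarrow>
        \<bar>?f u - A * u powr (p - 1)\<bar> \<le> e * u powr (p - 1)"
    using 1(2) by (rule AE_mp) (auto simp: indicator_def)
  have main: "\<bar>conv f g t / t powr (p + q - 1) - A * B * Beta p q\<bar> < \<epsilon>"
    if t: "0 < t" "t < min \<eta>1 \<eta>2" for t
  proof -
    let ?k = "\<lambda>s. indicator {0..t} s * ((t - s) powr (p - 1) * s powr (q - 1))"
    let ?c = "\<lambda>s. indicator {0..t} s * (?f (t - s) * ?g s)"
    have k: "integrable lborel ?k" "integral\<^sup>L lborel ?k = Beta p q * t powr (p + q - 1)"
      using has_bochner_integral_Beta_interval[OF p q t(1)] by (auto simp: has_bochner_integral_iff)
    (* The estimate for f is transported to f (t - s): a reflection preserves null sets. *)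
    let ?P = "\<lambda>u. 0 < u \<and> u < \<eta>1 \<longrightarrow> \<bar>?f u - A * u powr (p - 1)\<bar> \<le> e * u powr (p - 1)"
    have mP: "Measurable.pred borel ?P" by measurable
    have "AE s in lborel. ?P (t + (- 1) * s)"
      by (rule AE_borel_affine[of "- 1" ?P t, OF _ mP bd1]) simp
    moreover have "AE s in lborel. s \<noteq> 0 \<and> s \<noteq> t"
      using AE_lborel_singleton[of 0] AE_lborel_singleton[of t] by eventually_elim auto
    ultimately have bd: "AE s in lborel. \<bar>?c s - A * B * ?k s\<bar> \<le> e * (\<bar>A\<bar> + \<bar>B\<bar> + 1) * ?k s"
      using 2(2)
    proof eventually_elim
      case (elim s)
      show ?case
      proof (cases "s \<in> {0..t}")
        case False then show ?thesis by simp
      next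
        case True
        then have s: "0 < s" "s < t" using elim by auto
        let ?x = "(t - s) powr (p - 1)" and ?y = "s powr (q - 1)"
        have F: "\<bar>f (t - s) - A * ?x\<bar> \<le> e * ?x"
          using elim(1) s t by simp
        have G: "\<bar>g s - B * ?y\<bar> \<le> e * ?y"
          using elim(3) s t by simp
        have "\<bar>g s\<bar> \<le> \<bar>g s - B * ?y\<bar> + \<bar>B * ?y\<bar>" by linarith
        also have "\<dots> \<le> e * ?y + \<bar>B\<bar> * ?y" using G by (simp add: abs_mult)
        also have "\<dots> = (e + \<bar>B\<bar>) * ?y" by (simp add: distrib_right)
        also have "\<dots> \<le> (1 + \<bar>B\<bar>) * ?y" using e(2) by (intro mult_right_mono) auto
        finally have gb: "\<bar>g s\<bar> \<le> (1 + \<bar>B\<bar>) * ?y" .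
        have "f (t - s) * g s - A * B * (?x * ?y) = (f (t - s) - A * ?x) * g s + A * ?x * (g s - B * ?y)"
          by (simp add: algebra_simps)
        also have "\<bar>\<dots>\<bar> \<le> \<bar>f (t - s) - A * ?x\<bar> * \<bar>g s\<bar> + \<bar>A\<bar> * ?x * \<bar>g s - B * ?y\<bar>"
          by (rule order_trans[OF abs_triangle_ineq]) (simp add: abs_mult)
        also have "\<dots> \<le> (e * ?x) * ((1 + \<bar>B\<bar>) * ?y) + \<bar>A\<bar> * ?x * (e * ?y)"
          using F G gb e by (intro add_mono mult_mono) auto
        also have "\<dots> = (e * (\<bar>A\<bar> + \<bar>B\<bar> + 1)) * (?x * ?y)" by (simp add: algebra_simps)
        finally show ?thesis using s by simp
      qed
    qed
    have "integrable lborel (\<lambda>s. ?c s - A * B * ?k s)"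
    proof (rule Bochner_Integration.integrable_bound)
      show "integrable lborel (\<lambda>s. e * (\<bar>A\<bar> + \<bar>B\<bar> + 1) * ?k s)"
        using k(1) by (rule integrable_mult_right)
      have [measurable]: "(\<lambda>s. ?f (t - s)) \<in> borel_measurable borel"
        by (rule measurable_compose[of _ _ borel ?f]) auto
      show "(\<lambda>s. ?c s - A * B * ?k s) \<in> borel_measurable lborel" by measurable
      show "AE s in lborel. norm (?c s - A * B * ?k s) \<le> norm (e * (\<bar>A\<bar> + \<bar>B\<bar> + 1) * ?k s)"
        using bd
      proof eventually_elim
        case (elim s)
        then show ?case unfolding real_norm_def by (rule order_trans[OF _ abs_ge_self])
      qed
    qed
    from Bochner_Integration.integrable_add[OF this integrable_mult_right[OF k(1), of "A * B"]]
    have c: "integrable lborel ?c" by simp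
    have "\<bar>conv f g t - A * B * (Beta p q * t powr (p + q - 1))\<bar> = \<bar>\<integral>s. ?c s - A * B * ?k s \<partial>lborel\<bar>"
    proof -
      have "(\<integral>s. ?c s - A * B * ?k s \<partial>lborel) = (\<integral>s. ?c s \<partial>lborel) - (\<integral>s. A * B * ?k s \<partial>lborel)"
        using c k(1) by (intro Bochner_Integration.integral_diff integrable_mult_right)
      also have "\<dots> = conv f g t - A * B * (Beta p q * t powr (p + q - 1))"
        unfolding conv_restrict_half_line integral_mult_right_zero k(2) ..
      finally show ?thesis by simp
    qed
    also have "\<dots> \<le> (\<integral>s. e * (\<bar>A\<bar> + \<bar>B\<bar> + 1) * ?k s \<partial>lborel)"
    proof (rule order_trans[OF integral_abs_bound integral_mono_AE])
      show "integrable lborel (\<lambda>s. \<bar>?c s - A * B * ?k s\<bar>)"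
        using c k(1) by (intro integrable_abs Bochner_Integration.integrable_diff integrable_mult_right)
      show "integrable lborel (\<lambda>s. e * (\<bar>A\<bar> + \<bar>B\<bar> + 1) * ?k s)"
        using k(1) by (intro integrable_mult_right)
    qed (rule bd)
    also have "\<dots> = e * ((\<bar>A\<bar> + \<bar>B\<bar> + 1) * Beta p q) * t powr (p + q - 1)"
      unfolding integral_mult_right_zero k(2) by (simp only: mult_ac)
    finally have "\<bar>conv f g t - A * B * (Beta p q * t powr (p + q - 1))\<bar>
        \<le> e * ((\<bar>A\<bar> + \<bar>B\<bar> + 1) * Beta p q) * t powr (p + q - 1)" .
    moreover have "\<bar>conv f g t / t powr (p + q - 1) - A * B * Beta p q\<bar>
        = \<bar>conv f g t - A * B * (Beta p q * t powr (p + q - 1))\<bar> / t powr (p + q - 1)"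
    proof -
      have "conv f g t / t powr (p + q - 1) - A * B * Beta p q
          = (conv f g t - A * B * (Beta p q * t powr (p + q - 1))) / t powr (p + q - 1)"
        using t by (simp add: diff_divide_distrib)
      then show ?thesis by simp
    qed
    ultimately have "\<bar>conv f g t / t powr (p + q - 1) - A * B * Beta p q\<bar> \<le> e * ((\<bar>A\<bar> + \<bar>B\<bar> + 1) * Beta p q)"
      using t by (simp only: divide_le_eq) auto
    with e3 show ?thesis by linarith
  qed
  show "\<forall>\<^sub>F t in at_right 0. dist (conv f g t / t powr (p + q - 1)) (A * B * Beta p q) < \<epsilon>"
    unfolding eventually_at_right_field dist_real_def
    using 1(1) 2(1) main by (intro exI[of _ "min \<eta>1 \<eta>2"]) auto
qed

text \<open>Conversely, an ordinary limit gives the almost-everywhere version, so that a convolution can be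
  convolved again.\<close>

lemma ae_power_near_0_of_limit:
  assumes "set_borel_measurable lborel {0..} f"
    and "((\<lambda>t. f t / t powr (p - 1)) \<longlongrightarrow> A) (at_right 0)"
  shows "ae_power_near_0 f A p"
  unfolding ae_power_near_0_def
proof (intro conjI allI impI)
  fix \<epsilon> :: real assume "\<epsilon> > 0"
  then have "\<forall>\<^sub>F t in at_right 0. dist (f t / t powr (p - 1)) A < \<epsilon>"
    using assms(2) by (rule tendstoD[rotated])
  then obtain \<eta> where \<eta>: "\<eta> > 0" "\<And>t. 0 < t \<Longrightarrow> t < \<eta> \<Longrightarrow> \<bar>f t / t powr (p - 1) - A\<bar> < \<epsilon>"
    unfolding eventually_at_right_field dist_real_def by auto
  have "\<bar>f u - A * u powr (p - 1)\<bar> \<le> \<epsilon> * u powr (p - 1)" if u: "0 < u \<and> u < \<eta>" for u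
  proof -
    have "\<bar>f u - A * u powr (p - 1)\<bar> = \<bar>f u / u powr (p - 1) - A\<bar> * u powr (p - 1)"
    proof -
      have "f u - A * u powr (p - 1) = (f u / u powr (p - 1) - A) * u powr (p - 1)"
        using u by (simp add: left_diff_distrib)
      then show ?thesis by (simp add: abs_mult)
    qed
    also have "\<dots> \<le> \<epsilon> * u powr (p - 1)"
      using \<eta>(2)[of u] u by (intro mult_right_mono) auto
    finally show ?thesis .
  qed
  then show "\<exists>\<eta>>0. AE u in lborel. 0 < u \<and> u < \<eta> \<longrightarrow> \<bar>f u - A * u powr (p - 1)\<bar> \<le> \<epsilon> * u powr (p - 1)"
    using \<eta>(1) by auto
qed (use assms in auto)

lemma ae_power_near_0_conv:
  assumes f: "ae_power_near_0 f A p" and g: "ae_power_near_0 g B q" and "p > 0" "q > 0"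
  shows "ae_power_near_0 (conv f g) (A * B * Beta p q) (p + q)"
proof (rule ae_power_near_0_of_limit)
  have [measurable]: "conv f g \<in> borel_measurable borel"
    using f g by (intro conv_measurable) (auto simp: ae_power_near_0_def)
  show "set_borel_measurable lborel {0..} (conv f g)"
    unfolding set_borel_measurable_def by measurable
qed (use conv_power_limit[OF assms] in simp)

lemma ae_power_near_0_one: "ae_power_near_0 (\<lambda>_. 1) 1 1"
  unfolding ae_power_near_0_def set_borel_measurable_def
  by (auto intro!: exI[of _ 1])

lemma ae_power_near_0_cmult:
  assumes "ae_power_near_0 f A p"
  shows "ae_power_near_0 (\<lambda>u. c * f u) (c * A) p"
proof -
  have "ae_power_near_0 (\<lambda>_. c) c 1"
    unfolding ae_power_near_0_def set_borel_measurable_def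
    by (auto intro!: exI[of _ 1])
  from ae_power_near_0_mult[OF this assms] show ?thesis by simp
qed

lemma Beta_1_left:
  fixes p :: real
  assumes "p > 0"
  shows "Beta 1 p = 1 / p"
proof -
  have "Gamma p > 0" using assms by (rule Gamma_real_pos)
  moreover have "Gamma (p + 1) = p * Gamma p"
    using assms by (intro Gamma_plus1) (auto elim!: nonpos_Ints_cases)
  ultimately show ?thesis by (simp add: Beta_def add.commute)
qed

lemma tendsto_add_higher_power:
  fixes f g :: "real \<Rightarrow> real"
  assumes f: "((\<lambda>t. f t / t powr p) \<longlongrightarrow> A) (at_right 0)"
    and g: "((\<lambda>t. g t / t powr q) \<longlongrightarrow> B) (at_right 0)" and pq: "p < q"
  shows "((\<lambda>t. (f t + g t) / t powr p) \<longlongrightarrow> A) (at_right 0)"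
proof -
  have "((\<lambda>t::real. t powr (q - p)) \<longlongrightarrow> 0) (at_right 0)"
    using pq eventually_at_right_less[of 0]
    by (intro tendsto_zero_powrI[where b = "q - p"] tendsto_ident_at tendsto_const) (auto elim: eventually_mono)
  from tendsto_add[OF f tendsto_mult[OF g this]]
  have "((\<lambda>t. f t / t powr p + g t / t powr q * t powr (q - p)) \<longlongrightarrow> A) (at_right 0)" by simp
  moreover have "\<forall>\<^sub>F t in at_right 0. f t / t powr p + g t / t powr q * t powr (q - p) = (f t + g t) / t powr p"
    using eventually_at_right_less[of 0]
  proof eventually_elim
    case (elim t)
    then show ?case by (simp add: powr_diff add_divide_distrib)
  qed
  ultimately show ?thesis by (rule Lim_transform_eventually)
qed

lemma conv_one_eq: "conv (\<lambda>_. 1) f t = (LINT w:{0..t}|lborel. f w)"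
  by (simp add: conv_def)

section \<open>Laplace transforms and the singularity of the Mittag-Leffler kernel\<close>

text \<open>Uniqueness of Laplace transforms from their values at the natural numbers.  After the
  substitution \<open>x = exp (- u)\<close> the hypothesis says that all polynomials in \<open>x\<close> integrate to \<open>0\<close>
  against \<open>h\<close>; by the Weierstrass theorem so do all continuous functions on \<open>[0,1]\<close>, and by
  dominated convergence so do the indicators of \<open>{a<..}\<close>.  Hence the positive and the negative part
  of \<open>h\<close> are densities of the same measure.\<close>

lemma laplace_moments_zero_imp_AE_zero:
  fixes h :: "real \<Rightarrow> real"
  assumes h: "integrable lborel h" and supp: "\<And>u. u < 0 \<Longrightarrow> h u = 0"
    and zero: "\<And>n::nat. (\<integral>u. exp (- (real n * u)) * h u \<partial>lborel) = 0"
  shows "AE u in lborel. h u = 0"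
proof -
  have [measurable]: "h \<in> borel_measurable borel" using h by auto
  have int_bdd: "integrable lborel (\<lambda>u. \<phi> (exp (- u)) * h u)"
    if [measurable]: "\<phi> \<in> borel_measurable borel" and b: "\<And>x. x \<in> {0..1} \<Longrightarrow> \<bar>\<phi> x\<bar> \<le> B" for \<phi> and B :: real
  proof (rule Bochner_Integration.integrable_bound[OF integrable_mult_right[OF h, of B]])
    show "AE u in lborel. norm (\<phi> (exp (- u)) * h u) \<le> norm (B * h u)"
    proof (rule AE_I2)
      fix u :: real
      show "norm (\<phi> (exp (- u)) * h u) \<le> norm (B * h u)"
      proof (cases "u < 0")
        case True then show ?thesis by (simp add: supp)
      next
        case False
        then have "\<bar>\<phi> (exp (- u))\<bar> \<le> \<bar>B\<bar>" using b[of "exp (- u)"] by auto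
        then show ?thesis by (simp add: abs_mult mult_right_mono)
      qed
    qed
  qed measurable
  have cont_zero: "(\<integral>u. \<phi> (exp (- u)) * h u \<partial>lborel) = 0"
    if \<phi>: "continuous_on UNIV \<phi>" for \<phi> :: "real \<Rightarrow> real"
  proof -
    have [measurable]: "\<phi> \<in> borel_measurable borel"
      using \<phi> by (rule borel_measurable_continuous_onI)
    have "bounded (\<phi> ` {0..1})"
      using \<phi> by (intro compact_imp_bounded compact_continuous_image) (auto intro: continuous_on_subset)
    then obtain B where B: "\<And>x. x \<in> {0..1} \<Longrightarrow> \<bar>\<phi> x\<bar> \<le> B"
      unfolding bounded_iff by fastforce
    have "\<bar>\<integral>u. \<phi> (exp (- u)) * h u \<partial>lborel\<bar> \<le> e * (\<integral>u. \<bar>h u\<bar> \<partial>lborel)" if e0: "e > 0" for e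
    proof -
      obtain g where g: "real_polynomial_function g" "\<And>x. x \<in> {0..1} \<Longrightarrow> \<bar>\<phi> x - g x\<bar> < e"
        by (rule Stone_Weierstrass_real_polynomial_function[OF compact_Icc continuous_on_subset[OF \<phi> subset_UNIV] e0])
          (rule that)
      obtain a n where an: "g = (\<lambda>x. \<Sum>i\<le>n. a i * x ^ i)"
        using g(1) unfolding real_polynomial_function_iff_sum by blast
      have ig: "integrable lborel (\<lambda>u. exp (- (real i * u)) * h u)" for i
        using int_bdd[of "\<lambda>x. x ^ i" 1] by (auto simp: power_le_one exp_of_nat_mult[symmetric])
      have ga: "g (exp (- u)) * h u = (\<Sum>i\<le>n. a i * (exp (- (real i * u)) * h u))" for u
        by (simp add: an sum_distrib_right exp_of_nat_mult[symmetric] mult.assoc)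
      have g0: "(\<integral>u. g (exp (- u)) * h u \<partial>lborel) = 0"
        unfolding ga by (simp add: ig zero)
      have gi: "integrable lborel (\<lambda>u. g (exp (- u)) * h u)"
        unfolding ga by (simp add: ig)
      have i1: "integrable lborel (\<lambda>u. \<phi> (exp (- u)) * h u)" using B by (rule int_bdd[rotated]) auto
      have "(\<integral>u. \<phi> (exp (- u)) * h u \<partial>lborel) = (\<integral>u. \<phi> (exp (- u)) * h u - g (exp (- u)) * h u \<partial>lborel)"
        using g0 gi i1 by simp
      also have "\<bar>\<dots>\<bar> \<le> (\<integral>u. \<bar>\<phi> (exp (- u)) * h u - g (exp (- u)) * h u\<bar> \<partial>lborel)"
        by (rule integral_abs_bound)
      also have "\<dots> \<le> (\<integral>u. e * \<bar>h u\<bar> \<partial>lborel)"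
      proof (rule integral_mono)
        show "integrable lborel (\<lambda>u. \<bar>\<phi> (exp (- u)) * h u - g (exp (- u)) * h u\<bar>)"
          using i1 gi by auto
        fix u :: real
        show "\<bar>\<phi> (exp (- u)) * h u - g (exp (- u)) * h u\<bar> \<le> e * \<bar>h u\<bar>"
        proof (cases "u < 0")
          case True then show ?thesis by (simp add: supp)
        next
          case False
          then have "\<bar>\<phi> (exp (- u)) - g (exp (- u))\<bar> \<le> e" using g(2)[of "exp (- u)"] by auto
          then show ?thesis by (simp add: abs_mult mult_right_mono left_diff_distrib[symmetric])
        qed
      qed (use h in auto)
      finally show ?thesis by simp
    qed
    then have le: "\<bar>\<integral>u. \<phi> (exp (- u)) * h u \<partial>lborel\<bar> \<le> e * ((\<integral>u. \<bar>h u\<bar> \<partial>lborel) + 1)" if "e > 0" for e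
      using that by (smt (verit) mult_left_mono)
    have N: "(\<integral>u. \<bar>h u\<bar> \<partial>lborel) + 1 > 0"
      by (intro add_nonneg_pos integral_nonneg_AE) auto
    have "\<bar>\<integral>u. \<phi> (exp (- u)) * h u \<partial>lborel\<bar> \<le> 0"
    proof (rule field_le_epsilon)
      fix e :: real assume "e > 0"
      then show "\<bar>\<integral>u. \<phi> (exp (- u)) * h u \<partial>lborel\<bar> \<le> 0 + e"
        using le[of "e / ((\<integral>u. \<bar>h u\<bar> \<partial>lborel) + 1)"] N by simp
    qed
    then show ?thesis by simp
  qed
  have tail: "(\<integral>u. indicator {a<..} u * h u \<partial>lborel) = 0" for a :: real
  proof -
    (* Continuous functions of x = exp (- u) that increase to the indicator of x < exp (- a), that is, of u > a. *)
    let ?\<phi> = "\<lambda>m x::real. min 1 (max 0 (real m * (exp (- a) - x)))"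
    have "(\<lambda>m. \<integral>u. ?\<phi> m (exp (- u)) * h u \<partial>lborel) \<longlonglongrightarrow> (\<integral>u. indicator {a<..} u * h u \<partial>lborel)"
    proof (rule integral_dominated_convergence)
      show "integrable lborel (\<lambda>u. \<bar>h u\<bar>)" using h by auto
      show "AE u in lborel. (\<lambda>m. ?\<phi> m (exp (- u)) * h u) \<longlonglongrightarrow> indicator {a<..} u * h u"
      proof (rule AE_I2)
        fix u :: real
        have "(\<lambda>m. ?\<phi> m (exp (- u))) \<longlonglongrightarrow> indicator {a<..} u"
        proof (cases "a < u")
          case True
          then have pos: "exp (- a) - exp (- u) > 0" by simp
          have "\<forall>\<^sub>F m in sequentially. ?\<phi> m (exp (- u)) = 1"
            using eventually_ge_at_top[of "nat \<lceil>1 / (exp (- a) - exp (- u))\<rceil>"]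
          proof eventually_elim
            case (elim m)
            then have "1 / (exp (- a) - exp (- u)) \<le> real m" by linarith
            then have "1 \<le> real m * (exp (- a) - exp (- u))" using pos by (simp add: pos_divide_le_eq)
            then show ?case by simp
          qed
          then show ?thesis using True by (simp add: tendsto_eventually)
        next
          case False
          then have "real m * (exp (- a) - exp (- u)) \<le> 0" for m
            by (intro mult_nonneg_nonpos) auto
          then have "?\<phi> m (exp (- u)) = 0" for m by (simp add: max_absorb1)
          then show ?thesis using False by simp
        qed
        then show "(\<lambda>m. ?\<phi> m (exp (- u)) * h u) \<longlonglongrightarrow> indicator {a<..} u * h u"
          by (intro tendsto_intros)
      qed
      show "AE u in lborel. norm (?\<phi> m (exp (- u)) * h u) \<le> \<bar>h u\<bar>" for m
        by (intro AE_I2) (auto simp: abs_mult intro!: mult_left_le_one_le)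
    qed measurable
    moreover have "(\<integral>u. ?\<phi> m (exp (- u)) * h u \<partial>lborel) = 0" for m
      by (intro cont_zero continuous_intros)
    ultimately show ?thesis by (simp add: LIMSEQ_const_iff)
  qed
  let ?p = "\<lambda>u. max 0 (h u)" and ?n = "\<lambda>u. max 0 (- h u)"
  have em: "emeasure (density lborel (\<lambda>u. ennreal (g u))) {a<..} = ennreal (\<integral>u. indicator {a<..} u * max 0 (g u) \<partial>lborel)"
    if g: "integrable lborel g" for g :: "real \<Rightarrow> real" and a
  proof -
    have [measurable]: "g \<in> borel_measurable borel" using g by auto
    have "emeasure (density lborel (\<lambda>u. ennreal (g u))) {a<..} = (\<integral>\<^sup>+u. ennreal (indicator {a<..} u * max 0 (g u)) \<partial>lborel)"
      by (subst emeasure_density) (auto intro!: nn_integral_cong simp: indicator_def ennreal_neg max_def)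
    also have "integrable lborel (\<lambda>u. indicator {a<..} u * max 0 (g u))"
      using integrable_mult_indicator[of "{a<..}" lborel "\<lambda>u. max 0 (g u)"] g by auto
    then have "(\<integral>\<^sup>+u. ennreal (indicator {a<..} u * max 0 (g u)) \<partial>lborel) = ennreal (\<integral>u. indicator {a<..} u * max 0 (g u) \<partial>lborel)"
      by (intro nn_integral_eq_integral) auto
    finally show ?thesis .
  qed
  have "density lborel (\<lambda>u. ennreal (h u)) = density lborel (\<lambda>u. ennreal (- h u))"
  proof (rule measure_eqI_lessThan)
    fix a :: real
    have i1: "integrable lborel (\<lambda>u. indicator {a<..} u * ?p u)" "integrable lborel (\<lambda>u. indicator {a<..} u * ?n u)"
      using integrable_mult_indicator[of "{a<..}" lborel "?p"] integrable_mult_indicator[of "{a<..}" lborel "?n"] h by auto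
    have "(\<integral>u. indicator {a<..} u * ?p u \<partial>lborel) - (\<integral>u. indicator {a<..} u * ?n u \<partial>lborel) = (\<integral>u. indicator {a<..} u * h u \<partial>lborel)"
      unfolding Bochner_Integration.integral_diff[OF i1, symmetric]
      by (rule Bochner_Integration.integral_cong) (auto simp: max_def)
    then have "(\<integral>u. indicator {a<..} u * ?p u \<partial>lborel) = (\<integral>u. indicator {a<..} u * ?n u \<partial>lborel)"
      using tail[of a] by simp
    then show "emeasure (density lborel (\<lambda>u. ennreal (h u))) {a<..} = emeasure (density lborel (\<lambda>u. ennreal (- h u))) {a<..}"
      using em[of h a] em[of "\<lambda>u. - h u" a] h by simp
    show "emeasure (density lborel (\<lambda>u. ennreal (h u))) {a<..} < \<infinity>"
      using em[of h a] h by simp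
  qed auto
  then have "AE u in lborel. ennreal (h u) = ennreal (- h u)"
    by (subst (asm) sigma_finite_measure.density_unique_iff[OF sigma_finite_lborel]) auto
  then show ?thesis
  proof eventually_elim
    case (elim u)
    then show ?case by (cases "h u \<ge> 0") (auto simp: ennreal_neg ennreal_eq_0_iff dest: sym)
  qed
qed

lemma has_bochner_integral_laplace_powr:
  fixes x p :: real
  assumes "x > 0" "p > 0"
  shows "has_bochner_integral lborel (\<lambda>u. indicator {0..} u * (exp (- (x * u)) * u powr (p - 1)))
           (Gamma p * x powr (- p))"
proof -
  have "has_bochner_integral lborel (\<lambda>t. indicator {0..} t * t powr (p - 1) / exp t) (Gamma p)"
  proof (rule has_bochner_integral_nn_integral)
    show "(\<integral>\<^sup>+t. ennreal (indicator {0..} t * t powr (p - 1) / exp t) \<partial>lborel) = ennreal (Gamma p)"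
      using nn_integral_has_integral_lebesgue[OF _ Gamma_integral_real[OF assms(2)]] by simp
  qed (use assms in \<open>auto intro: less_imp_le\<close>)
  then have "has_bochner_integral lborel (\<lambda>u. indicator {0..} (0 + x * u) * (0 + x * u) powr (p - 1) / exp (0 + x * u)) (Gamma p /\<^sub>R \<bar>x\<bar>)"
    using assms by (subst (asm) lborel_has_bochner_integral_real_affine_iff[of x _ _ 0]) auto
  then have "has_bochner_integral lborel (\<lambda>u. x powr (1 - p) * (indicator {0..} (0 + x * u) * (0 + x * u) powr (p - 1) / exp (0 + x * u))) (x powr (1 - p) * (Gamma p /\<^sub>R \<bar>x\<bar>))"
    by (rule has_bochner_integral_mult_right)
  also have "(\<lambda>u. x powr (1 - p) * (indicator {0..} (0 + x * u) * (0 + x * u) powr (p - 1) / exp (0 + x * u)))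
     = (\<lambda>u. indicator {0..} u * (exp (- (x * u)) * u powr (p - 1)))"
  proof
    fix u
    have "x powr (1 - p) * x powr (p - 1) = 1" using assms by (simp add: powr_add[symmetric])
    then have "x powr (1 - p) * (x powr (p - 1) * y) = y" for y by (simp only: mult.assoc[symmetric])
    then show "x powr (1 - p) * (indicator {0..} (0 + x * u) * (0 + x * u) powr (p - 1) / exp (0 + x * u))
     = indicator {0..} u * (exp (- (x * u)) * u powr (p - 1))"
      using assms by (auto simp: indicator_def zero_le_mult_iff powr_mult exp_minus divide_inverse)
  qed
  also have "x powr (1 - p) * (Gamma p /\<^sub>R \<bar>x\<bar>) = Gamma p * x powr (- p)"
  proof -
    have "x powr (1 - p) = x * x powr (- p)" using assms by (simp add: powr_add[symmetric] powr_mult_base)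
    then show ?thesis using assms by simp
  qed
  finally show ?thesis .
qed

text \<open>Fubini and translation invariance: integration is multiplicative on the convolution algebra
  of the line.\<close>

lemma
  fixes h k :: "real \<Rightarrow> real"
  assumes h: "integrable lborel h" and k: "integrable lborel k"
  shows integrable_convolution: "integrable lborel (\<lambda>u. \<integral>s. h (u - s) * k s \<partial>lborel)"
    and integral_convolution: "(\<integral>u. \<integral>s. h (u - s) * k s \<partial>lborel \<partial>lborel) = (\<integral>u. h u \<partial>lborel) * (\<integral>u. k u \<partial>lborel)"
proof -
  have [measurable]: "h \<in> borel_measurable borel" "k \<in> borel_measurable borel" using h k by auto
  have shift: "integrable lborel (\<lambda>u. h (u - s))" "(\<integral>u. h (u - s) \<partial>lborel) = (\<integral>u. h u \<partial>lborel)"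
      "(\<integral>u. \<bar>h (u - s)\<bar> \<partial>lborel) = (\<integral>u. \<bar>h u\<bar> \<partial>lborel)" for s
    using lborel_integrable_real_affine[OF h, of 1 "- s"] lborel_integral_real_affine[of 1 h "- s"]
      lborel_integral_real_affine[of 1 "\<lambda>u. \<bar>h u\<bar>" "- s"] by auto
  have pair: "integrable (lborel \<Otimes>\<^sub>M lborel) (\<lambda>(s, u). h (u - s) * k s)"
  proof (rule lborel_pair.Fubini_integrable)
    show "integrable lborel (\<lambda>x. \<integral>y. norm (case (x, y) of (s, u) \<Rightarrow> h (u - s) * k s) \<partial>lborel)"
      using k by (simp add: abs_mult shift)
    show "AE x in lborel. integrable lborel (\<lambda>y. case (x, y) of (s, u) \<Rightarrow> h (u - s) * k s)"
      by (simp add: shift)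
  qed measurable
  from lborel_pair.integrable_product_swap[OF pair]
  have pair': "integrable (lborel \<Otimes>\<^sub>M lborel) (\<lambda>(u, s). h (u - s) * k s)" by (simp add: split_beta)
  show "integrable lborel (\<lambda>u. \<integral>s. h (u - s) * k s \<partial>lborel)"
    using lborel_pair.integrable_fst[OF pair'] by simp
  show "(\<integral>u. \<integral>s. h (u - s) * k s \<partial>lborel \<partial>lborel) = (\<integral>u. h u \<partial>lborel) * (\<integral>u. k u \<partial>lborel)"
    using lborel_pair.Fubini_integral[OF pair] by (simp add: shift)
qed

lemma laplace_of_real_pos:
  fixes f :: "real \<Rightarrow> real" and x :: real
  shows "laplace f (of_real x) = of_real (\<integral>u. indicator {0..} u * (exp (- (x * u)) * f u) \<partial>lborel)"
proof -
  have "laplace f (of_real x) = (\<integral>u. complex_of_real (indicator {0..} u * (exp (- (x * u)) * f u)) \<partial>lborel)"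
    unfolding laplace_def set_lebesgue_integral_def
    by (rule Bochner_Integration.integral_cong) (auto simp: indicator_def exp_of_real[symmetric])
  also have "\<dots> = of_real (\<integral>u. indicator {0..} u * (exp (- (x * u)) * f u) \<partial>lborel)"
    by (rule integral_complex_of_real)
  finally show ?thesis .
qed

text \<open>The damping factor is at most \<open>1\<close> on the half line.\<close>

lemma integrable_exp_weighted:
  fixes f :: "real \<Rightarrow> real"
  assumes "in_L1 f" "x \<ge> 0"
  shows "integrable lborel (\<lambda>u. indicator {0..} u * (exp (- (x * u)) * f u))"
proof (rule Bochner_Integration.integrable_bound)
  show int: "integrable lborel (\<lambda>u. indicator {0..} u * f u)"
    using assms(1) by (simp add: in_L1_def set_integrable_def)
  have "(\<lambda>u. exp (- (x * u)) * (indicator {0..} u * f u)) \<in> borel_measurable lborel"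
    using borel_measurable_integrable[OF int] by (rule borel_measurable_times[rotated]) auto
  then show "(\<lambda>u. indicator {0..} u * (exp (- (x * u)) * f u)) \<in> borel_measurable lborel"
    by (simp add: mult_ac)
  show "AE u in lborel. norm (indicator {0..} u * (exp (- (x * u)) * f u)) \<le> norm (indicator {0..} u * f u)"
    using assms(2) by (intro AE_I2) (auto simp: indicator_def abs_mult intro!: mult_left_le_one_le)
qed

text \<open>The factor \<open>exp (- (x * u))\<close> splits as \<open>exp (- (x * (u - s))) * exp (- (x * s))\<close>, which turns the
  weighted one-sided convolution into a convolution of integrable functions on the whole line.\<close>

lemma laplace_conv_powr:
  fixes K :: "real \<Rightarrow> real"
  assumes K: "in_L1 K" and x: "x > 0" and p: "p > 0"
  shows "has_bochner_integral lborel
           (\<lambda>u. indicator {0..} u * (exp (- (x * u)) * conv (\<lambda>v. v powr (p - 1)) K u))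
           (Gamma p * x powr (- p) * (\<integral>u. indicator {0..} u * (exp (- (x * u)) * K u) \<partial>lborel))"
proof -
  let ?h = "\<lambda>u. indicator {0..} u * (exp (- (x * u)) * u powr (p - 1))"
  let ?k = "\<lambda>u. indicator {0..} u * (exp (- (x * u)) * K u)"
  have h: "integrable lborel ?h" "integral\<^sup>L lborel ?h = Gamma p * x powr (- p)"
    using has_bochner_integral_laplace_powr[OF x p] by (auto simp: has_bochner_integral_iff)
  have k: "integrable lborel ?k" using integrable_exp_weighted[OF K, of x] x by simp
  have eq: "(\<integral>s. ?h (u - s) * ?k s \<partial>lborel) = indicator {0..} u * (exp (- (x * u)) * conv (\<lambda>v. v powr (p - 1)) K u)" for u
  proof -
    have "?h (u - s) * ?k s = exp (- (x * u)) * (indicator {0..u} s * ((u - s) powr (p - 1) * K s))" for s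
    proof -
      have "exp (- (x * u)) = exp (- (x * (u - s))) * exp (- (x * s))"
        by (simp add: exp_add[symmetric] algebra_simps)
      then show ?thesis by (auto simp: indicator_def)
    qed
    then have "(\<integral>s. ?h (u - s) * ?k s \<partial>lborel) = exp (- (x * u)) * conv (\<lambda>v. v powr (p - 1)) K u"
      by (simp only: conv_def set_lebesgue_integral_def integral_mult_right_zero real_scaleR_def)
    moreover have "conv (\<lambda>v. v powr (p - 1)) K u = 0" if "u < 0"
      using that by (simp add: conv_def set_lebesgue_integral_def)
    ultimately show ?thesis by (auto simp: indicator_def)
  qed
  show ?thesis
    using integrable_convolution[OF h(1) k] integral_convolution[OF h(1) k]
    unfolding eq h(2) by (simp add: has_bochner_integral_iff)
qed

text \<open>The kernel solves the Volterra equation of order \<open>\<alpha>\<close> given by \<open>1 / (1 + d * z powr \<alpha>)\<close>; this is the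
  equation substituted once into itself.  One step is needed because the kernel of order
  \<open>2 * \<alpha>\<close> is bounded near \<open>0\<close> for \<open>\<alpha> > 1 / 2\<close>, while the one of order \<open>\<alpha>\<close> is singular and its
  convolution with a merely integrable function cannot be bounded pointwise.\<close>

lemma mittag_leffler_kernel_resolvent:
  assumes K: "mittag_leffler_kernel \<alpha> d K" and d: "d > 0" and \<alpha>: "\<alpha> > 0"
  shows "AE u in lborel. u \<ge> 0 \<longrightarrow>
    d\<^sup>2 * K u = d / Gamma \<alpha> * u powr (\<alpha> - 1) - 1 / Gamma (2 * \<alpha>) * u powr (2 * \<alpha> - 1)
      + 1 / Gamma (2 * \<alpha>) * conv (\<lambda>v. v powr (2 * \<alpha> - 1)) K u"
proof -
  have K1: "in_L1 K" using K by (simp add: mittag_leffler_kernel_def)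
  let ?c = "conv (\<lambda>v. v powr (2 * \<alpha> - 1)) K"
  let ?f = "\<lambda>u. d\<^sup>2 * K u - d / Gamma \<alpha> * u powr (\<alpha> - 1) + 1 / Gamma (2 * \<alpha>) * u powr (2 * \<alpha> - 1)
      - 1 / Gamma (2 * \<alpha>) * ?c u"
  have G: "Gamma \<alpha> > 0" "Gamma (2 * \<alpha>) > 0" using \<alpha> by (auto intro: Gamma_real_pos)
  have LK: "(\<integral>u. indicator {0..} u * (exp (- (x * u)) * K u) \<partial>lborel) = inverse (1 + d * x powr \<alpha>)" if x: "x > 0" for x
  proof -
    have "laplace K (of_real x) = inverse (1 + of_real d * of_real x powr of_real \<alpha>)"
      using K x by (simp add: mittag_leffler_kernel_def)
    also have "\<dots> = of_real (inverse (1 + d * x powr \<alpha>))" using x by (simp add: powr_of_real)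
    finally show ?thesis unfolding laplace_of_real_pos of_real_eq_iff .
  qed
  have main: "has_bochner_integral lborel (\<lambda>u. indicator {0..} u * (exp (- (x * u)) * ?f u)) 0" if x: "x > 0" for x
  proof -
    let ?X = "x powr \<alpha>"
    have X: "?X > 0" "x powr (- \<alpha>) = 1 / ?X" "x powr (- (2 * \<alpha>)) = 1 / ?X\<^sup>2"
      using x by (auto simp: powr_minus_divide power2_eq_square powr_add[symmetric])
    have 1: "has_bochner_integral lborel (\<lambda>u. indicator {0..} u * (exp (- (x * u)) * K u)) (inverse (1 + d * ?X))"
      using LK[OF x] integrable_exp_weighted[OF K1, of x] x by (simp add: has_bochner_integral_iff)
    have 2: "has_bochner_integral lborel (\<lambda>u. indicator {0..} u * (exp (- (x * u)) * u powr (\<alpha> - 1))) (Gamma \<alpha> * (1 / ?X))"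
      using has_bochner_integral_laplace_powr[OF x \<alpha>] unfolding X .
    have 3: "has_bochner_integral lborel (\<lambda>u. indicator {0..} u * (exp (- (x * u)) * u powr (2 * \<alpha> - 1))) (Gamma (2 * \<alpha>) * (1 / ?X\<^sup>2))"
      using has_bochner_integral_laplace_powr[OF x, of "2 * \<alpha>"] \<alpha> unfolding X by simp
    have 4: "has_bochner_integral lborel (\<lambda>u. indicator {0..} u * (exp (- (x * u)) * ?c u)) (Gamma (2 * \<alpha>) * (1 / ?X\<^sup>2) * inverse (1 + d * ?X))"
      using laplace_conv_powr[OF K1 x, of "2 * \<alpha>"] \<alpha> unfolding X LK[OF x] by simp
    have "has_bochner_integral lborel
       (\<lambda>u. d\<^sup>2 * (indicator {0..} u * (exp (- (x * u)) * K u))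
         - d / Gamma \<alpha> * (indicator {0..} u * (exp (- (x * u)) * u powr (\<alpha> - 1)))
         + 1 / Gamma (2 * \<alpha>) * (indicator {0..} u * (exp (- (x * u)) * u powr (2 * \<alpha> - 1)))
         - 1 / Gamma (2 * \<alpha>) * (indicator {0..} u * (exp (- (x * u)) * ?c u)))
       (d\<^sup>2 * inverse (1 + d * ?X) - d / Gamma \<alpha> * (Gamma \<alpha> * (1 / ?X))
         + 1 / Gamma (2 * \<alpha>) * (Gamma (2 * \<alpha>) * (1 / ?X\<^sup>2))
         - 1 / Gamma (2 * \<alpha>) * (Gamma (2 * \<alpha>) * (1 / ?X\<^sup>2) * inverse (1 + d * ?X)))"
      by (intro has_bochner_integral_add has_bochner_integral_diff has_bochner_integral_mult_right 1 2 3 4)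
    also have "(\<lambda>u. d\<^sup>2 * (indicator {0..} u * (exp (- (x * u)) * K u))
         - d / Gamma \<alpha> * (indicator {0..} u * (exp (- (x * u)) * u powr (\<alpha> - 1)))
         + 1 / Gamma (2 * \<alpha>) * (indicator {0..} u * (exp (- (x * u)) * u powr (2 * \<alpha> - 1)))
         - 1 / Gamma (2 * \<alpha>) * (indicator {0..} u * (exp (- (x * u)) * ?c u)))
       = (\<lambda>u. indicator {0..} u * (exp (- (x * u)) * ?f u))"
      by (simp add: fun_eq_iff algebra_simps)
    also have "d\<^sup>2 * inverse (1 + d * ?X) - d / Gamma \<alpha> * (Gamma \<alpha> * (1 / ?X))
         + 1 / Gamma (2 * \<alpha>) * (Gamma (2 * \<alpha>) * (1 / ?X\<^sup>2))
         - 1 / Gamma (2 * \<alpha>) * (Gamma (2 * \<alpha>) * (1 / ?X\<^sup>2) * inverse (1 + d * ?X)) = 0"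
    proof -
      have alg: "d\<^sup>2 * inverse (1 + d * X) - d / X + 1 / X\<^sup>2 - 1 / X\<^sup>2 * inverse (1 + d * X) = 0" if "X > 0" for X
      proof -
        have "1 + d * X > 0" using that d by (simp add: add_pos_nonneg)
        then show ?thesis using that by (simp add: divide_simps) (simp add: algebra_simps power2_eq_square)
      qed
      show ?thesis using alg[OF X(1)] G by simp
    qed
    finally show ?thesis .
  qed
  (* The weight exp (- u) makes the residual integrable; its moments are the Laplace transform at n + 1. *)
  have "AE u in lborel. indicator {0..} u * (exp (- (1 * u)) * ?f u) = 0"
  proof (rule laplace_moments_zero_imp_AE_zero)
    fix n :: nat
    have "exp (- (real n * u)) * (indicator {0..} u * (exp (- (1 * u)) * ?f u)) = indicator {0..} u * (exp (- (real (Suc n) * u)) * ?f u)" for u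
    proof -
      have "exp (- (real (Suc n) * u)) = exp (- (real n * u)) * exp (- (1 * u))"
        by (simp add: exp_add[symmetric] algebra_simps)
      then show ?thesis by (simp only: mult_ac)
    qed
    then show "(\<integral>u. exp (- (real n * u)) * (indicator {0..} u * (exp (- (1 * u)) * ?f u)) \<partial>lborel) = 0"
      using main[of "real (Suc n)"] by (simp only: has_bochner_integral_iff)
  qed (use main[of 1] in \<open>auto simp: has_bochner_integral_iff\<close>)
  then show ?thesis
    by eventually_elim (auto simp: indicator_def)
qed

text \<open>The remainder of the iterated equation is at most a constant times
  \<open>u powr (2 * \<alpha> - 1) = u powr \<alpha> * u powr (\<alpha> - 1)\<close>, which is of smaller order than the leading term.\<close>

lemma mittag_leffler_kernel_near_0:
  assumes K: "mittag_leffler_kernel \<alpha> d K" and d: "d > 0" and \<alpha>: "1 / 2 < \<alpha>" "\<alpha> < 1"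
  shows "ae_power_near_0 K (inverse (d * Gamma \<alpha>)) \<alpha>"
  unfolding ae_power_near_0_def
proof (intro conjI allI impI)
  have K1: "in_L1 K" using K by (simp add: mittag_leffler_kernel_def)
  then have Kint: "integrable lborel (\<lambda>u. indicator {0..} u * K u)"
    by (simp add: in_L1_def set_integrable_def)
  then show "set_borel_measurable lborel {0..} K"
    by (simp add: set_borel_measurable_def)
  fix \<epsilon> :: real assume "\<epsilon> > 0"
  have G: "Gamma \<alpha> > 0" "Gamma (2 * \<alpha>) > 0" using \<alpha> by (auto intro: Gamma_real_pos)
  have \<alpha>0: "\<alpha> > 0" using \<alpha> by simp
  define N where "N = (\<integral>s. \<bar>indicator {0..} s * K s\<bar> \<partial>lborel)"
  have N: "N \<ge> 0" unfolding N_def by (intro integral_nonneg_AE) auto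
  define D where "D = (1 + N) / Gamma (2 * \<alpha>) / d\<^sup>2"
  have D: "D > 0" using N G d by (auto simp: D_def)
  have cb: "\<bar>conv (\<lambda>v. v powr (2 * \<alpha> - 1)) K u\<bar> \<le> N * u powr (2 * \<alpha> - 1)" if "u > 0" for u
  proof -
    have "\<bar>conv (\<lambda>v. v powr (2 * \<alpha> - 1)) K u\<bar> \<le> (\<integral>s. \<bar>indicator {0..u} s *\<^sub>R ((u - s) powr (2 * \<alpha> - 1) * K s)\<bar> \<partial>lborel)"
      unfolding conv_def set_lebesgue_integral_def by (rule integral_abs_bound)
    also have "\<dots> \<le> (\<integral>s. u powr (2 * \<alpha> - 1) * \<bar>indicator {0..} s * K s\<bar> \<partial>lborel)"
    proof (rule integral_mono')
      show "integrable lborel (\<lambda>s. u powr (2 * \<alpha> - 1) * \<bar>indicator {0..} s * K s\<bar>)"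
        using Kint by auto
      fix s :: real
      show "\<bar>indicator {0..u} s *\<^sub>R ((u - s) powr (2 * \<alpha> - 1) * K s)\<bar> \<le> u powr (2 * \<alpha> - 1) * \<bar>indicator {0..} s * K s\<bar>"
        using \<alpha> by (auto simp: indicator_def abs_mult intro!: mult_right_mono powr_mono2)
    qed auto
    also have "\<dots> = N * u powr (2 * \<alpha> - 1)" by (simp add: N_def)
    finally show ?thesis .
  qed
  define \<eta> where "\<eta> = (\<epsilon> / D) powr (1 / \<alpha>)"
  have "\<eta> > 0" using \<open>\<epsilon> > 0\<close> D by (simp add: \<eta>_def)
  moreover have "AE u in lborel. 0 < u \<and> u < \<eta> \<longrightarrow>
        \<bar>K u - inverse (d * Gamma \<alpha>) * u powr (\<alpha> - 1)\<bar> \<le> \<epsilon> * u powr (\<alpha> - 1)"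
    using mittag_leffler_kernel_resolvent[OF K d \<alpha>0]
  proof eventually_elim
    case (elim u)
    show ?case
    proof
      assume u: "0 < u \<and> u < \<eta>"
      let ?c = "conv (\<lambda>v. v powr (2 * \<alpha> - 1)) K u" and ?y = "u powr (2 * \<alpha> - 1)"
      have e: "d\<^sup>2 * K u = d / Gamma \<alpha> * u powr (\<alpha> - 1) - 1 / Gamma (2 * \<alpha>) * ?y + 1 / Gamma (2 * \<alpha>) * ?c"
        using elim u by simp
      have "K u - inverse (d * Gamma \<alpha>) * u powr (\<alpha> - 1) = (d\<^sup>2 * K u - d / Gamma \<alpha> * u powr (\<alpha> - 1)) / d\<^sup>2"
        using d G by (simp add: field_simps power2_eq_square)
      also have "\<dots> = (?c - ?y) / Gamma (2 * \<alpha>) / d\<^sup>2"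
        unfolding e by (simp add: diff_divide_distrib)
      also have "\<bar>\<dots>\<bar> = \<bar>?c - ?y\<bar> / Gamma (2 * \<alpha>) / d\<^sup>2" using G d by simp
      also have "\<dots> \<le> ((1 + N) * ?y) / Gamma (2 * \<alpha>) / d\<^sup>2"
      proof -
        have "\<bar>?c - ?y\<bar> \<le> \<bar>?c\<bar> + ?y" using powr_ge_zero[of u "2 * \<alpha> - 1"] by linarith
        also have "\<dots> \<le> (1 + N) * ?y" using cb[of u] u by (simp add: algebra_simps)
        finally show ?thesis using G by (intro divide_right_mono) auto
      qed
      also have "\<dots> = D * ?y" by (simp add: D_def)
      also have "?y = u powr \<alpha> * u powr (\<alpha> - 1)" by (simp add: powr_add[symmetric])
      also have "D * (u powr \<alpha> * u powr (\<alpha> - 1)) \<le> \<epsilon> * u powr (\<alpha> - 1)"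
      proof -
        have "u powr \<alpha> \<le> \<eta> powr \<alpha>" using u \<alpha> by (intro powr_mono2) auto
        also have "\<dots> = \<epsilon> / D" using \<alpha> \<open>\<epsilon> > 0\<close> D by (simp add: \<eta>_def powr_powr)
        finally have "D * u powr \<alpha> \<le> \<epsilon>" using D by (simp add: field_simps)
        then show ?thesis by (simp add: mult.assoc[symmetric] mult_right_mono)
      qed
      finally show "\<bar>K u - inverse (d * Gamma \<alpha>) * u powr (\<alpha> - 1)\<bar> \<le> \<epsilon> * u powr (\<alpha> - 1)" .
    qed
  qed
  ultimately show "\<exists>\<eta>>0. AE u in lborel. 0 < u \<and> u < \<eta> \<longrightarrow>
        \<bar>K u - inverse (d * Gamma \<alpha>) * u powr (\<alpha> - 1)\<bar> \<le> \<epsilon> * u powr (\<alpha> - 1)"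
    by blast
qed

section \<open>Limits in mean square\<close>

lemma integrable_mult_of_squares:
  fixes f g :: "'a \<Rightarrow> real"
  assumes "f \<in> borel_measurable N" "g \<in> borel_measurable N"
    and "integrable N (\<lambda>x. (f x)\<^sup>2)" "integrable N (\<lambda>x. (g x)\<^sup>2)"
  shows "integrable N (\<lambda>x. f x * g x)"
proof (rule Bochner_Integration.integrable_bound)
  show "integrable N (\<lambda>x. (f x)\<^sup>2 + (g x)\<^sup>2)" using assms by auto
  show "(\<lambda>x. f x * g x) \<in> borel_measurable N" using assms by (intro borel_measurable_times)
  have "\<bar>a * b\<bar> \<le> a\<^sup>2 + b\<^sup>2" for a b :: real
  proof -
    have "2 * (\<bar>a\<bar> * \<bar>b\<bar>) \<le> a\<^sup>2 + b\<^sup>2"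
      using sum_squares_bound[of "\<bar>a\<bar>" "\<bar>b\<bar>"] by (simp add: mult.assoc)
    moreover have "0 \<le> \<bar>a\<bar> * \<bar>b\<bar>" by simp
    ultimately show ?thesis by (simp only: abs_mult)
  qed
  then show "AE x in N. norm (f x * g x) \<le> norm ((f x)\<^sup>2 + (g x)\<^sup>2)"
    by (intro AE_I2) (auto intro: order_trans abs_ge_self)
qed

lemma square_integrable_add:
  fixes f g :: "'a \<Rightarrow> real"
  assumes "f \<in> borel_measurable N" "g \<in> borel_measurable N"
    and "integrable N (\<lambda>x. (f x)\<^sup>2)" "integrable N (\<lambda>x. (g x)\<^sup>2)"
  shows "integrable N (\<lambda>x. (f x + g x)\<^sup>2)"
  using integrable_mult_of_squares[OF assms] assms(3,4)
  by (auto simp: power2_sum mult.assoc intro!: Bochner_Integration.integrable_add)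

lemma square_integrable_cmult:
  fixes f :: "'a \<Rightarrow> real"
  assumes "integrable N (\<lambda>x. (f x)\<^sup>2)"
  shows "integrable N (\<lambda>x. (c * f x)\<^sup>2)"
  using assms by (simp add: power_mult_distrib)

lemma square_integrable_sum:
  fixes f :: "'i \<Rightarrow> 'a \<Rightarrow> real"
  assumes "finite I" "\<And>i. i \<in> I \<Longrightarrow> f i \<in> borel_measurable N"
    and "\<And>i. i \<in> I \<Longrightarrow> integrable N (\<lambda>x. (f i x)\<^sup>2)"
  shows "integrable N (\<lambda>x. (\<Sum>i\<in>I. f i x)\<^sup>2)"
  using assms by (induction I rule: finite_induct) (auto intro!: square_integrable_add)

lemma Cauchy_Schwarz_integral:
  fixes f g :: "'a \<Rightarrow> real"
  assumes [measurable]: "f \<in> borel_measurable N" "g \<in> borel_measurable N"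
    and f: "integrable N (\<lambda>x. (f x)\<^sup>2)" and g: "integrable N (\<lambda>x. (g x)\<^sup>2)"
  shows "\<bar>\<integral>x. f x * g x \<partial>N\<bar> \<le> sqrt (\<integral>x. (f x)\<^sup>2 \<partial>N) * sqrt (\<integral>x. (g x)\<^sup>2 \<partial>N)"
proof -
  have fg: "integrable N (\<lambda>x. \<bar>f x\<bar> * \<bar>g x\<bar>)"
    using integrable_abs[OF integrable_mult_of_squares[OF assms]] by (simp add: abs_mult)
  have sq: "(\<integral>\<^sup>+x. ennreal \<bar>h x\<bar> ^ 2 \<partial>N) = ennreal (\<integral>x. (h x)\<^sup>2 \<partial>N)"
    if "integrable N (\<lambda>x. (h x)\<^sup>2)" for h :: "'a \<Rightarrow> real"
    using nn_integral_eq_integral[OF that] by (simp add: ennreal_power)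
  have "(\<integral>\<^sup>+x. ennreal \<bar>f x\<bar> * ennreal \<bar>g x\<bar> \<partial>N)\<^sup>2 \<le>
      (\<integral>\<^sup>+x. ennreal \<bar>f x\<bar> ^ 2 \<partial>N) * (\<integral>\<^sup>+x. ennreal \<bar>g x\<bar> ^ 2 \<partial>N)"
    by (rule Cauchy_Schwarz_nn_integral) measurable
  moreover have "(\<integral>\<^sup>+x. ennreal \<bar>f x\<bar> * ennreal \<bar>g x\<bar> \<partial>N) = ennreal (\<integral>x. \<bar>f x\<bar> * \<bar>g x\<bar> \<partial>N)"
    using nn_integral_eq_integral[OF fg] by (simp add: ennreal_mult)
  ultimately have "ennreal ((\<integral>x. \<bar>f x\<bar> * \<bar>g x\<bar> \<partial>N)\<^sup>2) \<le> ennreal ((\<integral>x. (f x)\<^sup>2 \<partial>N) * (\<integral>x. (g x)\<^sup>2 \<partial>N))"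
    unfolding sq[OF f] sq[OF g] by (simp add: ennreal_power ennreal_mult integral_nonneg_AE)
  then have "(\<integral>x. \<bar>f x\<bar> * \<bar>g x\<bar> \<partial>N)\<^sup>2 \<le> (\<integral>x. (f x)\<^sup>2 \<partial>N) * (\<integral>x. (g x)\<^sup>2 \<partial>N)"
    by (subst (asm) ennreal_le_iff) (auto intro!: mult_nonneg_nonneg integral_nonneg_AE)
  then have "(\<integral>x. \<bar>f x\<bar> * \<bar>g x\<bar> \<partial>N) \<le> sqrt ((\<integral>x. (f x)\<^sup>2 \<partial>N) * (\<integral>x. (g x)\<^sup>2 \<partial>N))"
    by (rule real_le_rsqrt)
  moreover have "\<bar>\<integral>x. f x * g x \<partial>N\<bar> \<le> (\<integral>x. \<bar>f x\<bar> * \<bar>g x\<bar> \<partial>N)"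
    using integral_abs_bound[of N "\<lambda>x. f x * g x"] by (simp add: abs_mult)
  ultimately show ?thesis by (simp add: real_sqrt_mult)
qed

text \<open>The limit is known to be measurable only; its square-integrability comes from a single
  approximant at finite distance.\<close>

lemma L2_limit_square_integrable:
  fixes f :: "'a \<Rightarrow> real" and f' :: "nat \<Rightarrow> 'a \<Rightarrow> real"
  assumes [measurable]: "f \<in> borel_measurable N" "\<And>k. f' k \<in> borel_measurable N"
    and f': "\<And>k. integrable N (\<lambda>x. (f' k x)\<^sup>2)"
    and lim: "(\<lambda>k. \<integral>\<^sup>+x. ennreal ((f x - f' k x)\<^sup>2) \<partial>N) \<longlonglongrightarrow> 0"
  shows "integrable N (\<lambda>x. (f x)\<^sup>2)"
    and "integrable N (\<lambda>x. (f x - f' k x)\<^sup>2)"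
    and "(\<lambda>k. \<integral>x. (f x - f' k x)\<^sup>2 \<partial>N) \<longlonglongrightarrow> 0"
proof -
  have "\<forall>\<^sub>F k in sequentially. (\<integral>\<^sup>+x. ennreal ((f x - f' k x)\<^sup>2) \<partial>N) < 1"
    by (rule order_tendstoD(2)[OF lim]) simp
  then obtain k0 where "(\<integral>\<^sup>+x. ennreal ((f x - f' k0 x)\<^sup>2) \<partial>N) < 1"
    by (auto simp: eventually_sequentially)
  then have "integrable N (\<lambda>x. (f x - f' k0 x)\<^sup>2)"
    by (intro integrableI_nonneg) (auto intro: less_trans ennreal_one_less_top)
  from square_integrable_add[OF _ _ this f'[of k0]]
  show f: "integrable N (\<lambda>x. (f x)\<^sup>2)" by simp
  show d: "integrable N (\<lambda>x. (f x - f' k x)\<^sup>2)" for k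
    using square_integrable_add[OF _ _ f square_integrable_cmult[OF f'[of k], of "- 1"]] by simp
  have "(\<integral>\<^sup>+x. ennreal ((f x - f' k x)\<^sup>2) \<partial>N) = ennreal (\<integral>x. (f x - f' k x)\<^sup>2 \<partial>N)" for k
    by (rule nn_integral_eq_integral[OF d]) simp
  with lim have "(\<lambda>k. ennreal (\<integral>x. (f x - f' k x)\<^sup>2 \<partial>N)) \<longlonglongrightarrow> ennreal 0" by simp
  then show "(\<lambda>k. \<integral>x. (f x - f' k x)\<^sup>2 \<partial>N) \<longlonglongrightarrow> 0"
    by (subst (asm) tendsto_ennreal_iff) (auto intro!: always_eventually integral_nonneg_AE)
qed

text \<open>Continuity of the inner product.  It is used both on the probability space, for the stochastic
  integrals, and on its product with Lebesgue measure, for the integrands.\<close>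

lemma L2_limit_integral_mult:
  fixes f g :: "'a \<Rightarrow> real" and f' g' :: "nat \<Rightarrow> 'a \<Rightarrow> real"
  assumes fm[measurable]: "f \<in> borel_measurable N" "\<And>k. f' k \<in> borel_measurable N"
    and gm[measurable]: "g \<in> borel_measurable N" "\<And>k. g' k \<in> borel_measurable N"
    and f': "\<And>k. integrable N (\<lambda>x. (f' k x)\<^sup>2)" and g': "\<And>k. integrable N (\<lambda>x. (g' k x)\<^sup>2)"
    and limf: "(\<lambda>k. \<integral>\<^sup>+x. ennreal ((f x - f' k x)\<^sup>2) \<partial>N) \<longlonglongrightarrow> 0"
    and limg: "(\<lambda>k. \<integral>\<^sup>+x. ennreal ((g x - g' k x)\<^sup>2) \<partial>N) \<longlonglongrightarrow> 0"
  shows "(\<lambda>k. \<integral>x. f' k x * g' k x \<partial>N) \<longlonglongrightarrow> (\<integral>x. f x * g x \<partial>N)"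
proof (rule Lim_null[THEN iffD2], rule Lim_null_comparison)
  note F = L2_limit_square_integrable[OF fm f' limf] and G = L2_limit_square_integrable[OF gm g' limg]
  let ?n = "\<lambda>h. sqrt (\<integral>x. (h x)\<^sup>2 \<partial>N)"
  show "\<forall>\<^sub>F k in sequentially. norm ((\<integral>x. f' k x * g' k x \<partial>N) - (\<integral>x. f x * g x \<partial>N))
     \<le> ?n (\<lambda>x. f x - f' k x) * ?n (\<lambda>x. g x - g' k x) + ?n (\<lambda>x. f x - f' k x) * ?n g + ?n f * ?n (\<lambda>x. g x - g' k x)"
  proof (rule always_eventually, rule allI)
    fix k
    have i: "integrable N (\<lambda>x. (f x - f' k x) * (g x - g' k x))" "integrable N (\<lambda>x. (f x - f' k x) * g x)"
      "integrable N (\<lambda>x. f x * (g x - g' k x))" "integrable N (\<lambda>x. f x * g x)"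
      using F(1,2) G(1,2) by (auto intro!: integrable_mult_of_squares)
    have "(\<integral>x. f' k x * g' k x \<partial>N) = (\<integral>x. (f x - f' k x) * (g x - g' k x) - (f x - f' k x) * g x - f x * (g x - g' k x) + f x * g x \<partial>N)"
      by (rule Bochner_Integration.integral_cong) (auto simp: algebra_simps)
    also have "\<dots> = (\<integral>x. (f x - f' k x) * (g x - g' k x) \<partial>N) - (\<integral>x. (f x - f' k x) * g x \<partial>N) - (\<integral>x. f x * (g x - g' k x) \<partial>N) + (\<integral>x. f x * g x \<partial>N)"
      using i by (simp only: Bochner_Integration.integral_diff Bochner_Integration.integral_add Bochner_Integration.integrable_diff)
    finally have "norm ((\<integral>x. f' k x * g' k x \<partial>N) - (\<integral>x. f x * g x \<partial>N)) \<le>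
       \<bar>\<integral>x. (f x - f' k x) * (g x - g' k x) \<partial>N\<bar> + \<bar>\<integral>x. (f x - f' k x) * g x \<partial>N\<bar> + \<bar>\<integral>x. f x * (g x - g' k x) \<partial>N\<bar>"
      unfolding real_norm_def by linarith
    also have "\<dots> \<le> ?n (\<lambda>x. f x - f' k x) * ?n (\<lambda>x. g x - g' k x) + ?n (\<lambda>x. f x - f' k x) * ?n g + ?n f * ?n (\<lambda>x. g x - g' k x)"
      using F(1,2) G(1,2) by (intro add_mono Cauchy_Schwarz_integral) auto
    finally show "norm ((\<integral>x. f' k x * g' k x \<partial>N) - (\<integral>x. f x * g x \<partial>N)) \<le> \<dots>" .
  qed
  have "(\<lambda>k. ?n (\<lambda>x. f x - f' k x)) \<longlonglongrightarrow> sqrt 0" "(\<lambda>k. ?n (\<lambda>x. g x - g' k x)) \<longlonglongrightarrow> sqrt 0"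
    by (intro tendsto_real_sqrt F(3) G(3))+
  then have a: "(\<lambda>k. ?n (\<lambda>x. f x - f' k x)) \<longlonglongrightarrow> 0" and b: "(\<lambda>k. ?n (\<lambda>x. g x - g' k x)) \<longlonglongrightarrow> 0"
    by simp_all
  show "(\<lambda>k. ?n (\<lambda>x. f x - f' k x) * ?n (\<lambda>x. g x - g' k x) + ?n (\<lambda>x. f x - f' k x) * ?n g + ?n f * ?n (\<lambda>x. g x - g' k x)) \<longlonglongrightarrow> 0"
    using tendsto_add[OF tendsto_add[OF tendsto_mult[OF a b] tendsto_mult[OF a tendsto_const]] tendsto_mult[OF tendsto_const b]]
    by simp
qed

lemma
  fixes f :: "'a \<Rightarrow> real" and g :: "'b \<Rightarrow> real"
  assumes "sigma_finite_measure N1" "sigma_finite_measure N2" and f: "integrable N1 f" and g: "integrable N2 g"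
  shows integrable_pair_mult: "integrable (N1 \<Otimes>\<^sub>M N2) (\<lambda>(x, y). f x * g y)"
    and integral_pair_mult: "(\<integral>z. (case z of (x, y) \<Rightarrow> f x * g y) \<partial>(N1 \<Otimes>\<^sub>M N2)) = (\<integral>x. f x \<partial>N1) * (\<integral>y. g y \<partial>N2)"
proof -
  interpret pair_sigma_finite N1 N2 using assms by (simp add: pair_sigma_finite_def)
  have [measurable]: "f \<in> borel_measurable N1" "g \<in> borel_measurable N2" using f g by auto
  show i: "integrable (N1 \<Otimes>\<^sub>M N2) (\<lambda>(x, y). f x * g y)"
    by (rule Fubini_integrable) (use f g in \<open>auto simp: abs_mult\<close>)
  show "(\<integral>z. (case z of (x, y) \<Rightarrow> f x * g y) \<partial>(N1 \<Otimes>\<^sub>M N2)) = (\<integral>x. f x \<partial>N1) * (\<integral>y. g y \<partial>N2)"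
    using integral_fst'[OF i] by simp
qed

section \<open>The Ito isometry for a pair of Brownian motions\<close>

text \<open>The part of the theory of two martingales \<open>B\<close>, \<open>W\<close> with covariation \<open>\<rho> * t\<close> that the
  isometry needs.  The value \<open>\<rho> = 1\<close> covers a single Brownian motion (\<open>B = W\<close>), the value
  \<open>\<rho> = 0\<close> two orthogonal ones, so that the isometry and the orthogonality are one theorem.\<close>

locale brownian_pair = prob_space M
  for M :: "'a measure" +
  fixes F :: "real \<Rightarrow> 'a measure" and B W :: "real \<Rightarrow> 'a \<Rightarrow> real" and \<rho> :: real
  assumes filtration: "filtration01 M F"
    and adapted: "t \<in> {0..1} \<Longrightarrow> B t \<in> borel_measurable (F t)" "t \<in> {0..1} \<Longrightarrow> W t \<in> borel_measurable (F t)"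
    and square_integrable_increment:
      "s \<in> {0..1} \<Longrightarrow> t \<in> {0..1} \<Longrightarrow> s \<le> t \<Longrightarrow> integrable M (\<lambda>\<omega>. (B t \<omega> - B s \<omega>)\<^sup>2)"
      "s \<in> {0..1} \<Longrightarrow> t \<in> {0..1} \<Longrightarrow> s \<le> t \<Longrightarrow> integrable M (\<lambda>\<omega>. (W t \<omega> - W s \<omega>)\<^sup>2)"
    and martingale_increment:
      "s \<in> {0..1} \<Longrightarrow> t \<in> {0..1} \<Longrightarrow> s \<le> t \<Longrightarrow> X \<in> borel_measurable (F s) \<Longrightarrow> integrable M (\<lambda>\<omega>. (X \<omega>)\<^sup>2)
        \<Longrightarrow> expectation (\<lambda>\<omega>. X \<omega> * (B t \<omega> - B s \<omega>)) = 0"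
      "s \<in> {0..1} \<Longrightarrow> t \<in> {0..1} \<Longrightarrow> s \<le> t \<Longrightarrow> X \<in> borel_measurable (F s) \<Longrightarrow> integrable M (\<lambda>\<omega>. (X \<omega>)\<^sup>2)
        \<Longrightarrow> expectation (\<lambda>\<omega>. X \<omega> * (W t \<omega> - W s \<omega>)) = 0"
    and covariation:
      "s \<in> {0..1} \<Longrightarrow> t \<in> {0..1} \<Longrightarrow> s \<le> t \<Longrightarrow> X \<in> borel_measurable (F s) \<Longrightarrow> (\<And>\<omega>. \<omega> \<in> space M \<Longrightarrow> \<bar>X \<omega>\<bar> \<le> C)
        \<Longrightarrow> expectation (\<lambda>\<omega>. X \<omega> * ((B t \<omega> - B s \<omega>) * (W t \<omega> - W s \<omega>))) = \<rho> * (t - s) * expectation X"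
begin

lemma space_F: "t \<in> {0..1} \<Longrightarrow> space (F t) = space M"
  using filtration by (auto simp: filtration01_def subalgebra_def)

lemma measurable_F_mono:
  assumes "X \<in> borel_measurable (F s)" "s \<in> {0..1}" "t \<in> {0..1}" "s \<le> t"
  shows "X \<in> borel_measurable (F t)"
proof -
  have "subalgebra (F t) (F s)"
    using filtration assms by (auto simp: filtration01_def subalgebra_def)
  then show ?thesis using assms(1) by (rule measurable_from_subalg)
qed

lemma measurable_F:
  assumes "X \<in> borel_measurable (F s)" "s \<in> {0..1}"
  shows "X \<in> borel_measurable M"
  using filtration assms by (auto simp: filtration01_def intro: measurable_from_subalg)

lemma swap: "brownian_pair M F W B \<rho>"
proof
  fix s t :: real and X :: "'a \<Rightarrow> real" and C
  assume "s \<in> {0..1}" "t \<in> {0..1}" "s \<le> t" "X \<in> borel_measurable (F s)" "\<And>\<omega>. \<omega> \<in> space M \<Longrightarrow> \<bar>X \<omega>\<bar> \<le> C"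
  from covariation[OF this] show "expectation (\<lambda>\<omega>. X \<omega> * ((W t \<omega> - W s \<omega>) * (B t \<omega> - B s \<omega>))) = \<rho> * (t - s) * expectation X"
    by (simp add: mult.commute)
qed (use filtration adapted square_integrable_increment martingale_increment in auto)

lemma square_integrable_bounded_mult:
  fixes \<xi> Y :: "'a \<Rightarrow> real"
  assumes [measurable]: "\<xi> \<in> borel_measurable M" "Y \<in> borel_measurable M" and C: "\<And>\<omega>. \<omega> \<in> space M \<Longrightarrow> \<bar>\<xi> \<omega>\<bar> \<le> C"
    and Y: "integrable M (\<lambda>\<omega>. (Y \<omega>)\<^sup>2)"
  shows "integrable M (\<lambda>\<omega>. (\<xi> \<omega> * Y \<omega>)\<^sup>2)"
proof (rule Bochner_Integration.integrable_bound[where f = "\<lambda>\<omega>. C\<^sup>2 * (Y \<omega>)\<^sup>2"])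
  show "integrable M (\<lambda>\<omega>. C\<^sup>2 * (Y \<omega>)\<^sup>2)" using Y by simp
  show "AE \<omega> in M. norm ((\<xi> \<omega> * Y \<omega>)\<^sup>2) \<le> norm (C\<^sup>2 * (Y \<omega>)\<^sup>2)"
  proof (rule AE_I2)
    fix \<omega> assume "\<omega> \<in> space M"
    then have "(\<xi> \<omega>)\<^sup>2 \<le> C\<^sup>2" using C[of \<omega>] by (simp add: abs_le_square_iff[symmetric])
    then show "norm ((\<xi> \<omega> * Y \<omega>)\<^sup>2) \<le> norm (C\<^sup>2 * (Y \<omega>)\<^sup>2)"
      by (simp add: power_mult_distrib mult_right_mono)
  qed
qed measurable

text \<open>A product of increments over two intervals is cut at the end points.  A piece of one motion that
  ends before the piece of the other begins contributes \<open>0\<close>, since a martingale increment is orthogonal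
  to the past; on the common part of the two intervals the covariation appears.\<close>

lemma expectation_increments_ordered:
  assumes abcd: "a \<in> {0..1}" "b \<in> {0..1}" "c \<in> {0..1}" "d \<in> {0..1}" "a \<le> b" "c \<le> d" "a \<le> c"
    and \<xi>: "\<xi> \<in> borel_measurable (F a)" "\<And>\<omega>. \<omega> \<in> space M \<Longrightarrow> \<bar>\<xi> \<omega>\<bar> \<le> C"
    and \<eta>: "\<eta> \<in> borel_measurable (F c)" "\<And>\<omega>. \<omega> \<in> space M \<Longrightarrow> \<bar>\<eta> \<omega>\<bar> \<le> D"
  shows "expectation (\<lambda>\<omega>. (\<xi> \<omega> * (B b \<omega> - B a \<omega>)) * (\<eta> \<omega> * (W d \<omega> - W c \<omega>)))
    = \<rho> * max 0 (min b d - max a c) * expectation (\<lambda>\<omega>. \<xi> \<omega> * \<eta> \<omega>)"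
proof -
  let ?\<zeta> = "\<lambda>\<omega>. \<xi> \<omega> * \<eta> \<omega>"
  have \<xi>c: "\<xi> \<in> borel_measurable (F c)" by (rule measurable_F_mono[OF \<xi>(1)]) (use abcd in auto)
  then have \<zeta>: "?\<zeta> \<in> borel_measurable (F c)" using \<eta>(1) by (rule borel_measurable_times)
  have \<zeta>b: "\<bar>?\<zeta> \<omega>\<bar> \<le> C * D" if "\<omega> \<in> space M" for \<omega>
    using \<xi>(2)[OF that] \<eta>(2)[OF that] by (auto simp: abs_mult intro!: mult_mono)
  have BF: "B u \<in> borel_measurable (F v)" "W u \<in> borel_measurable (F v)" if "u \<in> {0..1}" "v \<in> {0..1}" "u \<le> v" for u v
    using that by (auto intro: measurable_F_mono[OF adapted(1)] measurable_F_mono[OF adapted(2)])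
  have BM[measurable]: "B u \<in> borel_measurable M" "W u \<in> borel_measurable M" if "u \<in> {0..1}" for u
    using that by (auto intro: measurable_F[OF adapted(1)] measurable_F[OF adapted(2)])
  have \<zeta>M[measurable]: "?\<zeta> \<in> borel_measurable M" by (rule measurable_F[OF \<zeta>]) (use abcd in auto)
  have sqB: "integrable M (\<lambda>\<omega>. (?\<zeta> \<omega> * (B v \<omega> - B u \<omega>))\<^sup>2)" if "u \<in> {0..1}" "v \<in> {0..1}" "u \<le> v" for u v
    using that by (intro square_integrable_bounded_mult[OF \<zeta>M _ \<zeta>b] square_integrable_increment) auto
  have sqW: "integrable M (\<lambda>\<omega>. (?\<zeta> \<omega> * (W v \<omega> - W u \<omega>))\<^sup>2)" if "u \<in> {0..1}" "v \<in> {0..1}" "u \<le> v" for u v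
    using that by (intro square_integrable_bounded_mult[OF \<zeta>M _ \<zeta>b] square_integrable_increment) auto
  let ?P = "\<lambda>u v x y \<omega>. ?\<zeta> \<omega> * (B v \<omega> - B u \<omega>) * (W y \<omega> - W x \<omega>)"
  have int: "integrable M (?P u v x y)" if "u \<in> {0..1}" "v \<in> {0..1}" "u \<le> v" "x \<in> {0..1}" "y \<in> {0..1}" "x \<le> y" for u v x y
    using that by (intro integrable_mult_of_squares sqB square_integrable_increment) auto
  have before: "expectation (?P u v x y) = 0"
    if "u \<in> {0..1}" "v \<in> {0..1}" "u \<le> v" "x \<in> {0..1}" "y \<in> {0..1}" "x \<le> y" "v \<le> x" "c \<le> x" for u v x y
  proof (rule martingale_increment(2))
    have "?\<zeta> \<in> borel_measurable (F x)" by (rule measurable_F_mono[OF \<zeta>]) (use that abcd in auto)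
    then show "(\<lambda>\<omega>. ?\<zeta> \<omega> * (B v \<omega> - B u \<omega>)) \<in> borel_measurable (F x)"
      by (rule borel_measurable_times[OF _ borel_measurable_diff[OF BF(1) BF(1)]]) (use that in auto)
  qed (use that sqB in auto)
  have after: "expectation (?P u v x y) = 0"
    if "u \<in> {0..1}" "v \<in> {0..1}" "u \<le> v" "x \<in> {0..1}" "y \<in> {0..1}" "x \<le> y" "y \<le> u" "c \<le> u" for u v x y
  proof -
    have "?\<zeta> \<in> borel_measurable (F u)" by (rule measurable_F_mono[OF \<zeta>]) (use that abcd in auto)
    then have "(\<lambda>\<omega>. ?\<zeta> \<omega> * (W y \<omega> - W x \<omega>)) \<in> borel_measurable (F u)"
      by (rule borel_measurable_times[OF _ borel_measurable_diff[OF BF(2) BF(2)]]) (use that in auto)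
    from martingale_increment(1)[OF that(1-3) this sqW[OF that(4-6)]] show ?thesis
      by (simp add: mult_ac)
  qed
  have same: "expectation (?P c e c e) = \<rho> * (e - c) * expectation ?\<zeta>" if "e \<in> {0..1}" "c \<le> e" for e
    using covariation[OF abcd(3) that \<zeta> \<zeta>b] by (simp add: mult.assoc)
  have split: "expectation (?P a b c d) = expectation (?P a m c d) + expectation (?P m b c d)"
    if "m \<in> {a..b}" for m
  proof -
    have "expectation (?P a b c d) = expectation (\<lambda>\<omega>. ?P a m c d \<omega> + ?P m b c d \<omega>)"
      by (rule Bochner_Integration.integral_cong) (auto simp: algebra_simps)
    also have "\<dots> = expectation (?P a m c d) + expectation (?P m b c d)"
      using that abcd by (intro Bochner_Integration.integral_add int) auto
    finally show ?thesis .
  qed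
  have "expectation (?P a b c d) = \<rho> * max 0 (min b d - max a c) * expectation ?\<zeta>"
  proof (cases "b \<le> c")
    case True
    then show ?thesis using before[of a b c d] abcd by (simp add: max_def min_def)
  next
    case False
    (* From c on both increments start together; the longer one is cut where the shorter one ends. *)
    have "expectation (?P c b c d) = \<rho> * (min b d - c) * expectation ?\<zeta>"
    proof (cases "b \<le> d")
      case True
      have "expectation (?P c b c d) = expectation (\<lambda>\<omega>. ?P c b c b \<omega> + ?P c b b d \<omega>)"
        by (rule Bochner_Integration.integral_cong) (auto simp: algebra_simps)
      also have "\<dots> = expectation (?P c b c b) + expectation (?P c b b d)"
        using False True abcd by (intro Bochner_Integration.integral_add int) auto
      finally show ?thesis using same[of b] before[of c b b d] False True abcd by simp
    next
      case F: False
      have "expectation (?P c b c d) = expectation (\<lambda>\<omega>. ?P c d c d \<omega> + ?P d b c d \<omega>)"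
        by (rule Bochner_Integration.integral_cong) (auto simp: algebra_simps)
      also have "\<dots> = expectation (?P c d c d) + expectation (?P d b c d)"
        using False F abcd by (intro Bochner_Integration.integral_add int) auto
      finally show ?thesis using same[of d] after[of d b c d] False F abcd by simp
    qed
    then show ?thesis
      using split[of c] before[of a c c d] False abcd by (simp add: max_def min_def)
  qed
  then show ?thesis by (simp add: mult_ac)
qed

end

lemma (in brownian_pair) expectation_increments:
  assumes abcd: "a \<in> {0..1}" "b \<in> {0..1}" "c \<in> {0..1}" "d \<in> {0..1}" "a \<le> b" "c \<le> d"
    and \<xi>: "\<xi> \<in> borel_measurable (F a)" "\<And>\<omega>. \<omega> \<in> space M \<Longrightarrow> \<bar>\<xi> \<omega>\<bar> \<le> C"
    and \<eta>: "\<eta> \<in> borel_measurable (F c)" "\<And>\<omega>. \<omega> \<in> space M \<Longrightarrow> \<bar>\<eta> \<omega>\<bar> \<le> D"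
  shows "expectation (\<lambda>\<omega>. (\<xi> \<omega> * (B b \<omega> - B a \<omega>)) * (\<eta> \<omega> * (W d \<omega> - W c \<omega>)))
    = \<rho> * max 0 (min b d - max a c) * expectation (\<lambda>\<omega>. \<xi> \<omega> * \<eta> \<omega>)"
proof (cases "a \<le> c")
  case True
  from expectation_increments_ordered[OF abcd True \<xi> \<eta>] show ?thesis .
next
  case False
  then have "c \<le> a" by simp
  interpret sw: brownian_pair M F W B \<rho> by (rule swap)
  from sw.expectation_increments_ordered[OF abcd(3,4,1,2,6,5) \<open>c \<le> a\<close> \<eta> \<xi>] show ?thesis
    by (simp add: mult.commute min.commute max.commute)
qed

lemma integral_indicator_overlap:
  fixes a b c d :: real
  shows "(\<integral>s. indicator {a<..b} s * indicator {c<..d} s \<partial>lborel) = max 0 (min b d - max a c)"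
proof -
  have "(\<lambda>s. indicator {a<..b} s * indicator {c<..d} s :: real) = indicator {max a c<..min b d}"
    by (auto simp: indicator_def)
  moreover have "measure lborel {l<..u} = max 0 (u - l)" for l u :: real
    by (cases "l \<le> u") auto
  ultimately show ?thesis by simp
qed

lemma integrable_indicator_Ioc: "integrable lborel (indicator {a<..b::real} :: real \<Rightarrow> real)"
  by (cases "a \<le> b") auto

context brownian_pair
begin

lemma simple_integrandD:
  assumes "simple_integrand F t n \<tau> \<xi>" "t \<in> {0..1}" "i < n"
  shows "\<tau> i \<in> {0..1}" "\<tau> (Suc i) \<in> {0..1}" "\<tau> i \<le> \<tau> (Suc i)" "{\<tau> i<..\<tau> (Suc i)} \<subseteq> {0..t}"
    "\<xi> i \<in> borel_measurable (F (\<tau> i))" "\<xi> i \<in> borel_measurable M"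
    "\<exists>C. \<forall>\<omega>\<in>space M. \<bar>\<xi> i \<omega>\<bar> \<le> C"
proof -
  have \<tau>: "\<tau> i \<in> {0..t}" "\<tau> (Suc i) \<in> {0..t}"
    using assms by (simp_all add: simple_integrand_def)
  then show *: "\<tau> i \<in> {0..1}" and "\<tau> (Suc i) \<in> {0..1}" using assms(2) by auto
  show "{\<tau> i<..\<tau> (Suc i)} \<subseteq> {0..t}" using \<tau> by auto
  show "\<tau> i \<le> \<tau> (Suc i)" and \<xi>: "\<xi> i \<in> borel_measurable (F (\<tau> i))" using assms by (auto simp: simple_integrand_def)
  show "\<xi> i \<in> borel_measurable M" using \<xi> * by (rule measurable_F)
  show "\<exists>C. \<forall>\<omega>\<in>space M. \<bar>\<xi> i \<omega>\<bar> \<le> C"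
  proof -
    have "\<exists>C. \<forall>\<omega>\<in>space (F (\<tau> i)). \<bar>\<xi> i \<omega>\<bar> \<le> C" using assms(1,3) by (simp add: simple_integrand_def)
    then show ?thesis unfolding space_F[OF *] .
  qed
qed

lemma simple_integral_summand:
  assumes S: "simple_integrand F t n \<tau> \<xi>" "t \<in> {0..1}" "i < n"
  shows "(\<lambda>\<omega>. \<xi> i \<omega> * (B (\<tau> (Suc i)) \<omega> - B (\<tau> i) \<omega>)) \<in> borel_measurable M"
    and "integrable M (\<lambda>\<omega>. (\<xi> i \<omega> * (B (\<tau> (Suc i)) \<omega> - B (\<tau> i) \<omega>))\<^sup>2)"
proof -
  note D = simple_integrandD[OF S]
  have [measurable]: "\<xi> i \<in> borel_measurable M" "B (\<tau> i) \<in> borel_measurable M" "B (\<tau> (Suc i)) \<in> borel_measurable M"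
    using D(1,2,6) measurable_F[OF adapted(1)] by auto
  show "(\<lambda>\<omega>. \<xi> i \<omega> * (B (\<tau> (Suc i)) \<omega> - B (\<tau> i) \<omega>)) \<in> borel_measurable M" by measurable
  obtain C where C: "\<And>\<omega>. \<omega> \<in> space M \<Longrightarrow> \<bar>\<xi> i \<omega>\<bar> \<le> C" using D(7) by auto
  show "integrable M (\<lambda>\<omega>. (\<xi> i \<omega> * (B (\<tau> (Suc i)) \<omega> - B (\<tau> i) \<omega>))\<^sup>2)"
    by (rule square_integrable_bounded_mult[OF _ _ C square_integrable_increment(1)[OF D(1-3)]]) auto
qed

lemma simple_integral_square_integrable:
  assumes S: "simple_integrand F t n \<tau> \<xi>" "t \<in> {0..1}"
  shows "simple_integral B n \<tau> \<xi> \<in> borel_measurable M"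
    and "integrable M (\<lambda>\<omega>. (simple_integral B n \<tau> \<xi> \<omega>)\<^sup>2)"
  unfolding simple_integral_def[abs_def]
  using simple_integral_summand[OF S] by (auto intro!: borel_measurable_sum square_integrable_sum)

text \<open>The cut-off to \<open>{0..t}\<close> that accompanies the integrand in the definition of the Ito integral does not
  change simple integrands.\<close>

lemma simple_value_eq_0:
  assumes S: "simple_integrand F t n \<tau> \<xi>" "t \<in> {0..1}" and "s \<notin> {0..t}"
  shows "simple_value n \<tau> \<xi> s \<omega> = 0"
  unfolding simple_value_def
proof (rule sum.neutral, rule ballI)
  fix i assume "i \<in> {..<n}"
  then have "s \<notin> {\<tau> i<..\<tau> (Suc i)}" using simple_integrandD(4)[OF S, of i] assms(3) by auto
  then show "\<xi> i \<omega> * indicator {\<tau> i<..\<tau> (Suc i)} s = 0" by simp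
qed

lemma simple_value_square_integrable:
  assumes S: "simple_integrand F t n \<tau> \<xi>" "t \<in> {0..1}"
  shows "(\<lambda>(s, \<omega>). simple_value n \<tau> \<xi> s \<omega>) \<in> borel_measurable (lborel \<Otimes>\<^sub>M M)"
    and "integrable (lborel \<Otimes>\<^sub>M M) (\<lambda>z. (case z of (s, \<omega>) \<Rightarrow> simple_value n \<tau> \<xi> s \<omega>)\<^sup>2)"
proof -
  have m: "(\<lambda>z. \<xi> i (snd z) * indicator {\<tau> i<..\<tau> (Suc i)} (fst z)) \<in> borel_measurable (lborel \<Otimes>\<^sub>M M)" if "i < n" for i
  proof -
    have [measurable]: "\<xi> i \<in> borel_measurable M" using simple_integrandD(6)[OF S that] .
    show ?thesis by measurable
  qed
  show "(\<lambda>(s, \<omega>). simple_value n \<tau> \<xi> s \<omega>) \<in> borel_measurable (lborel \<Otimes>\<^sub>M M)"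
    unfolding simple_value_def split_beta using m by (intro borel_measurable_sum) auto
  have i: "integrable (lborel \<Otimes>\<^sub>M M) (\<lambda>z. (\<xi> i (snd z) * indicator {\<tau> i<..\<tau> (Suc i)} (fst z))\<^sup>2)" if i: "i < n" for i
  proof -
    obtain C where C: "\<And>\<omega>. \<omega> \<in> space M \<Longrightarrow> \<bar>\<xi> i \<omega>\<bar> \<le> C" using simple_integrandD(7)[OF S i] by auto
    have "integrable M (\<lambda>\<omega>. (\<xi> i \<omega> * 1)\<^sup>2)"
      by (rule square_integrable_bounded_mult[OF simple_integrandD(6)[OF S i] _ C]) auto
    then have "integrable M (\<lambda>\<omega>. (\<xi> i \<omega>)\<^sup>2)" by simp
    from integrable_pair_mult[OF sigma_finite_lborel sigma_finite_measure_axioms integrable_indicator_Ioc this, of "\<tau> i" "\<tau> (Suc i)"]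
    show ?thesis
      by (rule back_subst[of "integrable _"]) (auto simp: fun_eq_iff indicator_def)
  qed
  show "integrable (lborel \<Otimes>\<^sub>M M) (\<lambda>z. (case z of (s, \<omega>) \<Rightarrow> simple_value n \<tau> \<xi> s \<omega>)\<^sup>2)"
    unfolding simple_value_def split_beta using m i by (intro square_integrable_sum) auto
qed

text \<open>Both sides expand into double sums over pairs of intervals, with the length of the overlap as weight.\<close>

lemma simple_ito_isometry:
  assumes S: "simple_integrand F t n \<tau> \<xi>" "t \<in> {0..1}" and S': "simple_integrand F t m \<sigma> \<eta>"
  shows "expectation (\<lambda>\<omega>. simple_integral B n \<tau> \<xi> \<omega> * simple_integral W m \<sigma> \<eta> \<omega>)
    = \<rho> * (\<integral>z. (case z of (s, \<omega>) \<Rightarrow> simple_value n \<tau> \<xi> s \<omega> * simple_value m \<sigma> \<eta> s \<omega>) \<partial>(lborel \<Otimes>\<^sub>M M))"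
proof -
  interpret sw: brownian_pair M F W B \<rho> by (rule swap)
  let ?o = "\<lambda>i j. max 0 (min (\<tau> (Suc i)) (\<sigma> (Suc j)) - max (\<tau> i) (\<sigma> j))"
  let ?I = "\<lambda>i s. indicator {\<tau> i<..\<tau> (Suc i)} s :: real" and ?J = "\<lambda>j s. indicator {\<sigma> j<..\<sigma> (Suc j)} s :: real"
  have L: "expectation (\<lambda>\<omega>. simple_integral B n \<tau> \<xi> \<omega> * simple_integral W m \<sigma> \<eta> \<omega>)
     = (\<Sum>i<n. \<Sum>j<m. \<rho> * ?o i j * expectation (\<lambda>\<omega>. \<xi> i \<omega> * \<eta> j \<omega>))"
  proof -
    have "expectation (\<lambda>\<omega>. simple_integral B n \<tau> \<xi> \<omega> * simple_integral W m \<sigma> \<eta> \<omega>)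
      = (\<Sum>i<n. \<Sum>j<m. expectation (\<lambda>\<omega>. (\<xi> i \<omega> * (B (\<tau> (Suc i)) \<omega> - B (\<tau> i) \<omega>)) * (\<eta> j \<omega> * (W (\<sigma> (Suc j)) \<omega> - W (\<sigma> j) \<omega>))))"
      unfolding simple_integral_def sum_product
      using simple_integral_summand[OF S] sw.simple_integral_summand[OF S' S(2)]
      by (subst Bochner_Integration.integral_sum Bochner_Integration.integrable_sum,
          auto intro!: Bochner_Integration.integrable_sum integrable_mult_of_squares sum.cong Bochner_Integration.integral_sum)
    also have "\<dots> = (\<Sum>i<n. \<Sum>j<m. \<rho> * ?o i j * expectation (\<lambda>\<omega>. \<xi> i \<omega> * \<eta> j \<omega>))"
    proof (intro sum.cong refl)
      fix i j assume "i \<in> {..<n}" "j \<in> {..<m}"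
      then have ij: "i < n" "j < m" by auto
      note D = simple_integrandD[OF S ij(1)] and D' = simple_integrandD[OF S' S(2) ij(2)]
      obtain C where C: "\<And>\<omega>. \<omega> \<in> space M \<Longrightarrow> \<bar>\<xi> i \<omega>\<bar> \<le> C" using D(7) by auto
      obtain C' where C': "\<And>\<omega>. \<omega> \<in> space M \<Longrightarrow> \<bar>\<eta> j \<omega>\<bar> \<le> C'" using D'(7) by auto
      show "expectation (\<lambda>\<omega>. (\<xi> i \<omega> * (B (\<tau> (Suc i)) \<omega> - B (\<tau> i) \<omega>)) * (\<eta> j \<omega> * (W (\<sigma> (Suc j)) \<omega> - W (\<sigma> j) \<omega>)))
        = \<rho> * ?o i j * expectation (\<lambda>\<omega>. \<xi> i \<omega> * \<eta> j \<omega>)"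
        by (rule expectation_increments[OF D(1,2) D'(1,2) D(3) D'(3) D(5) C D'(5) C'])
    qed
    finally show ?thesis .
  qed
  have pm: "integrable (lborel \<Otimes>\<^sub>M M) (\<lambda>z. (\<xi> i (snd z) * ?I i (fst z)) * (\<eta> j (snd z) * ?J j (fst z)))"
    "(\<integral>z. (\<xi> i (snd z) * ?I i (fst z)) * (\<eta> j (snd z) * ?J j (fst z)) \<partial>(lborel \<Otimes>\<^sub>M M)) = ?o i j * expectation (\<lambda>\<omega>. \<xi> i \<omega> * \<eta> j \<omega>)"
    if ij: "i < n" "j < m" for i j
  proof -
    note D = simple_integrandD[OF S ij(1)] and D' = simple_integrandD[OF S' S(2) ij(2)]
    have sq: "integrable M (\<lambda>\<omega>. (X \<omega>)\<^sup>2)" if X: "X \<in> borel_measurable M" "\<exists>C. \<forall>\<omega>\<in>space M. \<bar>X \<omega>\<bar> \<le> C" for X :: "'a \<Rightarrow> real"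
    proof -
      obtain C where "\<And>\<omega>. \<omega> \<in> space M \<Longrightarrow> \<bar>X \<omega>\<bar> \<le> C" using X(2) by auto
      from square_integrable_bounded_mult[OF X(1) _ this, of "\<lambda>_. 1"] show ?thesis by simp
    qed
    have e: "integrable M (\<lambda>\<omega>. \<xi> i \<omega> * \<eta> j \<omega>)"
      using D(6,7) D'(6,7) by (intro integrable_mult_of_squares sq)
    have "(\<lambda>s. ?I i s * ?J j s) = indicator {max (\<tau> i) (\<sigma> j)<..min (\<tau> (Suc i)) (\<sigma> (Suc j))}"
      by (auto simp: indicator_def)
    then have ii: "integrable lborel (\<lambda>s. ?I i s * ?J j s)" by (simp add: integrable_indicator_Ioc)
    have eq: "(\<lambda>z. (\<xi> i (snd z) * ?I i (fst z)) * (\<eta> j (snd z) * ?J j (fst z))) = (\<lambda>(s, \<omega>). (?I i s * ?J j s) * (\<xi> i \<omega> * \<eta> j \<omega>))"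
      by (auto simp: fun_eq_iff)
    show "integrable (lborel \<Otimes>\<^sub>M M) (\<lambda>z. (\<xi> i (snd z) * ?I i (fst z)) * (\<eta> j (snd z) * ?J j (fst z)))"
      unfolding eq by (rule integrable_pair_mult[OF sigma_finite_lborel sigma_finite_measure_axioms ii e])
    show "(\<integral>z. (\<xi> i (snd z) * ?I i (fst z)) * (\<eta> j (snd z) * ?J j (fst z)) \<partial>(lborel \<Otimes>\<^sub>M M)) = ?o i j * expectation (\<lambda>\<omega>. \<xi> i \<omega> * \<eta> j \<omega>)"
      unfolding eq integral_pair_mult[OF sigma_finite_lborel sigma_finite_measure_axioms ii e] integral_indicator_overlap ..
  qed
  have "(\<integral>z. (case z of (s, \<omega>) \<Rightarrow> simple_value n \<tau> \<xi> s \<omega> * simple_value m \<sigma> \<eta> s \<omega>) \<partial>(lborel \<Otimes>\<^sub>M M))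
     = (\<Sum>i<n. \<Sum>j<m. ?o i j * expectation (\<lambda>\<omega>. \<xi> i \<omega> * \<eta> j \<omega>))"
    unfolding simple_value_def split_beta sum_product
    using pm
    by (subst Bochner_Integration.integral_sum,
          auto intro!: Bochner_Integration.integrable_sum sum.cong simp: Bochner_Integration.integral_sum)
  with L show ?thesis by (simp add: sum_distrib_left mult.assoc)
qed

text \<open>The iterated integral in the definition is rewritten over the product measure, where the
  approximation becomes convergence in mean square.\<close>

lemma has_ito_integral_approximation:
  assumes t: "t \<in> {0..1}" and X: "has_ito_integral M F B t H X"
  obtains n \<tau> \<xi> where "\<And>k::nat. simple_integrand F t (n k) (\<tau> k) (\<xi> k)"
    and "(\<lambda>k. \<integral>\<^sup>+z. ennreal (((case z of (s, \<omega>) \<Rightarrow> indicator {0..t} s * H s \<omega>) -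
            (case z of (s, \<omega>) \<Rightarrow> simple_value (n k) (\<tau> k) (\<xi> k) s \<omega>))\<^sup>2) \<partial>(lborel \<Otimes>\<^sub>M M)) \<longlonglongrightarrow> 0"
    and "(\<lambda>k. \<integral>\<^sup>+\<omega>. ennreal ((X \<omega> - simple_integral B (n k) (\<tau> k) (\<xi> k) \<omega>)\<^sup>2) \<partial>M) \<longlonglongrightarrow> 0"
proof -
  interpret P: pair_sigma_finite lborel M
    by (simp add: pair_sigma_finite_def sigma_finite_lborel sigma_finite_measure_axioms)
  have [measurable]: "(\<lambda>(s, \<omega>). indicator {0..t} s * H s \<omega>) \<in> borel_measurable (lborel \<Otimes>\<^sub>M M)"
    using X by (simp add: has_ito_integral_def)
  obtain n \<tau> \<xi> where S: "\<And>k::nat. simple_integrand F t (n k) (\<tau> k) (\<xi> k)"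
    and H: "(\<lambda>k. \<integral>\<^sup>+\<omega>. (\<integral>\<^sup>+s\<in>{0..t}. ennreal ((H s \<omega> - simple_value (n k) (\<tau> k) (\<xi> k) s \<omega>)\<^sup>2) \<partial>lborel) \<partial>M) \<longlonglongrightarrow> 0"
    and I: "(\<lambda>k. \<integral>\<^sup>+\<omega>. ennreal ((X \<omega> - simple_integral B (n k) (\<tau> k) (\<xi> k) \<omega>)\<^sup>2) \<partial>M) \<longlonglongrightarrow> 0"
    using X unfolding has_ito_integral_def by blast
  have "(\<integral>\<^sup>+\<omega>. (\<integral>\<^sup>+s\<in>{0..t}. ennreal ((H s \<omega> - simple_value (n k) (\<tau> k) (\<xi> k) s \<omega>)\<^sup>2) \<partial>lborel) \<partial>M)
     = (\<integral>\<^sup>+z. ennreal (((case z of (s, \<omega>) \<Rightarrow> indicator {0..t} s * H s \<omega>) -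
            (case z of (s, \<omega>) \<Rightarrow> simple_value (n k) (\<tau> k) (\<xi> k) s \<omega>))\<^sup>2) \<partial>(lborel \<Otimes>\<^sub>M M))" for k
  proof -
    have [measurable]: "(\<lambda>(s, \<omega>). simple_value (n k) (\<tau> k) (\<xi> k) s \<omega>) \<in> borel_measurable (lborel \<Otimes>\<^sub>M M)"
      by (rule simple_value_square_integrable(1)[OF S t])
    have "(\<integral>\<^sup>+z. ennreal (((case z of (s, \<omega>) \<Rightarrow> indicator {0..t} s * H s \<omega>) -
            (case z of (s, \<omega>) \<Rightarrow> simple_value (n k) (\<tau> k) (\<xi> k) s \<omega>))\<^sup>2) \<partial>(lborel \<Otimes>\<^sub>M M))
       = (\<integral>\<^sup>+\<omega>. (\<integral>\<^sup>+s. ennreal ((indicator {0..t} s * H s \<omega> - simple_value (n k) (\<tau> k) (\<xi> k) s \<omega>)\<^sup>2) \<partial>lborel) \<partial>M)"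
      by (subst P.nn_integral_snd[symmetric]) simp_all
    also have "\<dots> = (\<integral>\<^sup>+\<omega>. (\<integral>\<^sup>+s\<in>{0..t}. ennreal ((H s \<omega> - simple_value (n k) (\<tau> k) (\<xi> k) s \<omega>)\<^sup>2) \<partial>lborel) \<partial>M)"
      using simple_value_eq_0[OF S t]
      by (intro nn_integral_cong) (auto simp: indicator_def)
    finally show ?thesis ..
  qed
  then show thesis using H I by (intro that[OF S]) auto
qed

lemma has_ito_integral_moments:
  assumes t: "t \<in> {0..1}" and X: "has_ito_integral M F B t H X"
  shows "X \<in> borel_measurable M" and "integrable M (\<lambda>\<omega>. (X \<omega>)\<^sup>2)" and "expectation X = 0"
    and "(\<lambda>(s, \<omega>). indicator {0..t} s * H s \<omega>) \<in> borel_measurable (lborel \<Otimes>\<^sub>M M)"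
    and "integrable (lborel \<Otimes>\<^sub>M M) (\<lambda>z. (case z of (s, \<omega>) \<Rightarrow> indicator {0..t} s * H s \<omega>)\<^sup>2)"
proof -
  show Xm: "X \<in> borel_measurable M"
    and Hm: "(\<lambda>(s, \<omega>). indicator {0..t} s * H s \<omega>) \<in> borel_measurable (lborel \<Otimes>\<^sub>M M)"
    using X by (simp_all add: has_ito_integral_def)
  obtain n \<tau> \<xi> where S: "\<And>k::nat. simple_integrand F t (n k) (\<tau> k) (\<xi> k)"
    and H: "(\<lambda>k. \<integral>\<^sup>+z. ennreal (((case z of (s, \<omega>) \<Rightarrow> indicator {0..t} s * H s \<omega>) -
            (case z of (s, \<omega>) \<Rightarrow> simple_value (n k) (\<tau> k) (\<xi> k) s \<omega>))\<^sup>2) \<partial>(lborel \<Otimes>\<^sub>M M)) \<longlonglongrightarrow> 0"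
    and I: "(\<lambda>k. \<integral>\<^sup>+\<omega>. ennreal ((X \<omega> - simple_integral B (n k) (\<tau> k) (\<xi> k) \<omega>)\<^sup>2) \<partial>M) \<longlonglongrightarrow> 0"
    using has_ito_integral_approximation[OF t X] by blast
  note SI = simple_integral_square_integrable[OF S t]
  show "integrable M (\<lambda>\<omega>. (X \<omega>)\<^sup>2)"
    by (rule L2_limit_square_integrable(1)[OF Xm SI I])
  show "integrable (lborel \<Otimes>\<^sub>M M) (\<lambda>z. (case z of (s, \<omega>) \<Rightarrow> indicator {0..t} s * H s \<omega>)\<^sup>2)"
    by (rule L2_limit_square_integrable(1)[OF Hm simple_value_square_integrable[OF S t] H])
  have "(\<lambda>k. expectation (\<lambda>\<omega>. simple_integral B (n k) (\<tau> k) (\<xi> k) \<omega> * 1)) \<longlonglongrightarrow> expectation (\<lambda>\<omega>. X \<omega> * 1)"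
    by (rule L2_limit_integral_mult[OF Xm SI(1) _ _ SI(2) _ I]) auto
  moreover have "expectation (simple_integral B (n k) (\<tau> k) (\<xi> k)) = 0" for k
  proof -
    have "integrable M (\<lambda>\<omega>. \<xi> k i \<omega> * (B (\<tau> k (Suc i)) \<omega> - B (\<tau> k i) \<omega>))" if "i < n k" for i
      using integrable_mult_of_squares[OF simple_integral_summand(1)[OF S t that] _ simple_integral_summand(2)[OF S t that], of "\<lambda>_. 1"]
      by simp
    moreover have "expectation (\<lambda>\<omega>. \<xi> k i \<omega> * (B (\<tau> k (Suc i)) \<omega> - B (\<tau> k i) \<omega>)) = 0" if "i < n k" for i
    proof -
      note D = simple_integrandD[OF S t that]
      obtain C where C: "\<And>\<omega>. \<omega> \<in> space M \<Longrightarrow> \<bar>\<xi> k i \<omega>\<bar> \<le> C" using D(7) by auto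
      have "integrable M (\<lambda>\<omega>. (\<xi> k i \<omega>)\<^sup>2)"
        using square_integrable_bounded_mult[OF D(6) _ C, of "\<lambda>_. 1"] by simp
      then show ?thesis by (rule martingale_increment(1)[OF D(1-3,5)])
    qed
    ultimately show ?thesis unfolding simple_integral_def[abs_def] by simp
  qed
  ultimately show "expectation X = 0" by (simp add: LIMSEQ_const_iff)
qed

text \<open>The two integrands come with unrelated sequences of simple integrands; by continuity of the inner
  product it is enough to pair the \<open>k\<close>-th terms of the two sequences.\<close>

theorem has_ito_integral_isometry:
  assumes t: "t \<in> {0..1}" and X: "has_ito_integral M F B t H X" and Y: "has_ito_integral M F W t G Y"
  shows "expectation (\<lambda>\<omega>. X \<omega> * Y \<omega>) = \<rho> * (\<integral>z. (case z of (s, \<omega>) \<Rightarrow> indicator {0..t} s * H s \<omega>) *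
             (case z of (s, \<omega>) \<Rightarrow> indicator {0..t} s * G s \<omega>) \<partial>(lborel \<Otimes>\<^sub>M M))"
proof -
  interpret sw: brownian_pair M F W B \<rho> by (rule swap)
  obtain n \<tau> \<xi> where S: "\<And>k::nat. simple_integrand F t (n k) (\<tau> k) (\<xi> k)"
    and H: "(\<lambda>k. \<integral>\<^sup>+z. ennreal (((case z of (s, \<omega>) \<Rightarrow> indicator {0..t} s * H s \<omega>) -
            (case z of (s, \<omega>) \<Rightarrow> simple_value (n k) (\<tau> k) (\<xi> k) s \<omega>))\<^sup>2) \<partial>(lborel \<Otimes>\<^sub>M M)) \<longlonglongrightarrow> 0"
    and I: "(\<lambda>k. \<integral>\<^sup>+\<omega>. ennreal ((X \<omega> - simple_integral B (n k) (\<tau> k) (\<xi> k) \<omega>)\<^sup>2) \<partial>M) \<longlonglongrightarrow> 0"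
    using has_ito_integral_approximation[OF t X] by blast
  obtain m \<sigma> \<eta> where S': "\<And>k::nat. simple_integrand F t (m k) (\<sigma> k) (\<eta> k)"
    and G: "(\<lambda>k. \<integral>\<^sup>+z. ennreal (((case z of (s, \<omega>) \<Rightarrow> indicator {0..t} s * G s \<omega>) -
            (case z of (s, \<omega>) \<Rightarrow> simple_value (m k) (\<sigma> k) (\<eta> k) s \<omega>))\<^sup>2) \<partial>(lborel \<Otimes>\<^sub>M M)) \<longlonglongrightarrow> 0"
    and J: "(\<lambda>k. \<integral>\<^sup>+\<omega>. ennreal ((Y \<omega> - simple_integral W (m k) (\<sigma> k) (\<eta> k) \<omega>)\<^sup>2) \<partial>M) \<longlonglongrightarrow> 0"
    using sw.has_ito_integral_approximation[OF t Y] by blast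
  note SI = simple_integral_square_integrable[OF S t] and SJ = sw.simple_integral_square_integrable[OF S' t]
  have "(\<lambda>k. expectation (\<lambda>\<omega>. simple_integral B (n k) (\<tau> k) (\<xi> k) \<omega> * simple_integral W (m k) (\<sigma> k) (\<eta> k) \<omega>))
     \<longlonglongrightarrow> expectation (\<lambda>\<omega>. X \<omega> * Y \<omega>)"
    by (rule L2_limit_integral_mult[OF has_ito_integral_moments(1)[OF t X] SI(1) sw.has_ito_integral_moments(1)[OF t Y] SJ(1) SI(2) SJ(2) I J])
  moreover have "(\<lambda>k. \<integral>z. (case z of (s, \<omega>) \<Rightarrow> simple_value (n k) (\<tau> k) (\<xi> k) s \<omega>) *
             (case z of (s, \<omega>) \<Rightarrow> simple_value (m k) (\<sigma> k) (\<eta> k) s \<omega>) \<partial>(lborel \<Otimes>\<^sub>M M))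
      \<longlonglongrightarrow> (\<integral>z. (case z of (s, \<omega>) \<Rightarrow> indicator {0..t} s * H s \<omega>) *
             (case z of (s, \<omega>) \<Rightarrow> indicator {0..t} s * G s \<omega>) \<partial>(lborel \<Otimes>\<^sub>M M))"
    by (rule L2_limit_integral_mult[OF has_ito_integral_moments(4)[OF t X] simple_value_square_integrable(1)[OF S t]
        sw.has_ito_integral_moments(4)[OF t Y] simple_value_square_integrable(1)[OF S' t] simple_value_square_integrable(2)[OF S t] simple_value_square_integrable(2)[OF S' t] H G])
  then have "(\<lambda>k. \<rho> * (\<integral>z. (case z of (s, \<omega>) \<Rightarrow> simple_value (n k) (\<tau> k) (\<xi> k) s \<omega> * simple_value (m k) (\<sigma> k) (\<eta> k) s \<omega>) \<partial>(lborel \<Otimes>\<^sub>M M)))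
      \<longlonglongrightarrow> \<rho> * (\<integral>z. (case z of (s, \<omega>) \<Rightarrow> indicator {0..t} s * H s \<omega>) *
             (case z of (s, \<omega>) \<Rightarrow> indicator {0..t} s * G s \<omega>) \<partial>(lborel \<Otimes>\<^sub>M M))"
    by (intro tendsto_mult_left) (simp add: split_beta)
  ultimately show ?thesis
    unfolding simple_ito_isometry[OF S t S'] by (rule LIMSEQ_unique)
qed

end

lemma (in prob_space) brownian_increment:
  assumes B: "brownian_motion01 M F B" and st: "s \<in> {0..1}" "t \<in> {0..1}" "s \<le> t"
  shows "(\<lambda>\<omega>. B t \<omega> - B s \<omega>) \<in> borel_measurable M"
    and "integrable M (\<lambda>\<omega>. (B t \<omega> - B s \<omega>)\<^sup>2)"
    and "expectation (\<lambda>\<omega>. B t \<omega> - B s \<omega>) = 0"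
    and "expectation (\<lambda>\<omega>. (B t \<omega> - B s \<omega>)\<^sup>2) = t - s"
proof -
  have Bm: "B u \<in> borel_measurable M" if "u \<in> {0..1}" for u
    by (rule measurable_from_subalg[of M "F u"]) (use B that in \<open>auto simp: brownian_motion01_def filtration01_def\<close>)
  show "(\<lambda>\<omega>. B t \<omega> - B s \<omega>) \<in> borel_measurable M" using st Bm by auto
  have "integrable M (\<lambda>\<omega>. (B t \<omega> - B s \<omega>)\<^sup>2) \<and> expectation (\<lambda>\<omega>. B t \<omega> - B s \<omega>) = 0 \<and> expectation (\<lambda>\<omega>. (B t \<omega> - B s \<omega>)\<^sup>2) = t - s"
  proof (cases "s = t")
    case True then show ?thesis by simp
  next
    case False
    then have lt: "0 < sqrt (t - s)" using st by simp
    have D: "distributed M lborel (\<lambda>\<omega>. B t \<omega> - B s \<omega>) (normal_density 0 (sqrt (t - s)))"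
      using B st False by (simp add: brownian_motion01_def)
    have E: "expectation (\<lambda>\<omega>. B t \<omega> - B s \<omega>) = 0"
      using normal_distributed_expectation[OF lt D] .
    moreover have "expectation (\<lambda>\<omega>. (B t \<omega> - B s \<omega>)\<^sup>2) = t - s"
      using normal_distributed_variance[OF lt D] st unfolding E by simp
    moreover have "integrable M (\<lambda>\<omega>. (B t \<omega> - B s \<omega>)\<^sup>2)"
      using distributed_integrable[OF D, of "\<lambda>x. x\<^sup>2"] integrable_normal_moment[OF lt, of 0 2] by simp
    ultimately show ?thesis by simp
  qed
  then show "integrable M (\<lambda>\<omega>. (B t \<omega> - B s \<omega>)\<^sup>2)" "expectation (\<lambda>\<omega>. B t \<omega> - B s \<omega>) = 0"
     "expectation (\<lambda>\<omega>. (B t \<omega> - B s \<omega>)\<^sup>2) = t - s" by auto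
qed

text \<open>Independence of the \<open>\<sigma>\<close>-algebras is inherited by all functions measurable with respect to
  them.  For \<open>s = t\<close> there is no independence to use, but the increment vanishes.\<close>

lemma (in prob_space) brownian_increment_independent:
  fixes X :: "'a \<Rightarrow> real" and g :: "real \<Rightarrow> real"
  assumes B: "brownian_motion01 M F B" and st: "s \<in> {0..1}" "t \<in> {0..1}" "s \<le> t"
    and X: "X \<in> borel_measurable (F s)" "integrable M X"
    and g[measurable]: "g \<in> borel_measurable borel" and gi: "integrable M (\<lambda>\<omega>. g (B t \<omega> - B s \<omega>))"
  shows "expectation (\<lambda>\<omega>. X \<omega> * g (B t \<omega> - B s \<omega>)) = expectation X * expectation (\<lambda>\<omega>. g (B t \<omega> - B s \<omega>))"
proof (cases "s = t")
  case True then show ?thesis by (simp add: prob_space)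
next
  case False
  let ?D = "\<lambda>\<omega>. B t \<omega> - B s \<omega>"
  have Dm[measurable]: "?D \<in> borel_measurable M" by (rule brownian_increment(1)[OF B st])
  have sub: "subalgebra M (F s)" using B st by (simp add: brownian_motion01_def filtration01_def)
  have sp: "space (F s) = space M" using sub by (simp add: subalgebra_def)
  have Xm: "X \<in> borel_measurable M" using sub X(1) by (rule measurable_from_subalg)
  have ind: "indep_set (sets (F s)) (sets (vimage_algebra (space M) ?D borel))"
    using B st False by (simp add: brownian_motion01_def)
  have "{X -` A \<inter> space M |A. A \<in> sets borel} \<subseteq> sets (F s)"
    using measurable_sets[OF X(1)] sp by auto
  then have 1: "sigma_sets (space M) {X -` A \<inter> space M |A. A \<in> sets borel} \<subseteq> sets (F s)"
    unfolding sp[symmetric] by (rule sets.sigma_sets_subset)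
  have "{(\<lambda>\<omega>. g (?D \<omega>)) -` A \<inter> space M |A. A \<in> sets borel} \<subseteq> sets (vimage_algebra (space M) ?D borel)"
  proof safe
    fix A :: "real set" assume "A \<in> sets borel"
    then have "g -` A \<in> sets borel" using measurable_sets[OF g] by simp
    then have "?D -` (g -` A) \<inter> space M \<in> sets (vimage_algebra (space M) ?D borel)"
      by (rule in_vimage_algebra)
    then show "(\<lambda>\<omega>. g (?D \<omega>)) -` A \<inter> space M \<in> sets (vimage_algebra (space M) ?D borel)"
      by (simp add: vimage_def)
  qed
  then have 2: "sigma_sets (space M) {(\<lambda>\<omega>. g (?D \<omega>)) -` A \<inter> space M |A. A \<in> sets borel} \<subseteq> sets (vimage_algebra (space M) ?D borel)"
    using sets.sigma_sets_subset[of _ "vimage_algebra (space M) ?D borel"] by simp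
  have "indep_var borel X borel (\<lambda>\<omega>. g (?D \<omega>))"
  proof -
    have "indep_set (sigma_sets (space M) {X -` A \<inter> space M |A. A \<in> sets borel})
        (sigma_sets (space M) {(\<lambda>\<omega>. g (?D \<omega>)) -` A \<inter> space M |A. A \<in> sets borel})"
      using ind 1 2 unfolding indep_sets2_eq by blast
    then show ?thesis unfolding indep_var_eq using Xm by simp
  qed
  then show ?thesis using X(2) gi by (rule indep_var_lebesgue_integral)
qed

lemma (in prob_space) brownian_martingale_increment:
  assumes B: "brownian_motion01 M F B" and st: "s \<in> {0..1}" "t \<in> {0..1}" "s \<le> t"
    and X: "X \<in> borel_measurable (F s)" "integrable M (\<lambda>\<omega>. (X \<omega>)\<^sup>2)"
  shows "expectation (\<lambda>\<omega>. X \<omega> * (B t \<omega> - B s \<omega>)) = 0"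
proof -
  have Xm: "X \<in> borel_measurable M"
    by (rule measurable_from_subalg[OF _ X(1)]) (use B st in \<open>auto simp: brownian_motion01_def filtration01_def\<close>)
  have Xi: "integrable M X"
    using integrable_mult_of_squares[OF Xm _ X(2), of "\<lambda>_. 1"] by simp
  have Bi: "integrable M (\<lambda>\<omega>. B t \<omega> - B s \<omega>)"
    using integrable_mult_of_squares[OF brownian_increment(1)[OF B st] _ brownian_increment(2)[OF B st], of "\<lambda>_. 1"] by simp
  show ?thesis
    using brownian_increment_independent[OF B st X(1) Xi, of "\<lambda>x. x"] Bi brownian_increment(3)[OF B st] by simp
qed

lemma (in prob_space) brownian_pair_same:
  assumes B: "brownian_motion01 M F B"
  shows "brownian_pair M F B B 1"
proof
  fix s t :: real and X :: "'a \<Rightarrow> real" and C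
  assume st: "s \<in> {0..1}" "t \<in> {0..1}" "s \<le> t" and X: "X \<in> borel_measurable (F s)" "\<And>\<omega>. \<omega> \<in> space M \<Longrightarrow> \<bar>X \<omega>\<bar> \<le> C"
  have Xm: "X \<in> borel_measurable M"
    by (rule measurable_from_subalg[OF _ X(1)]) (use B st in \<open>auto simp: brownian_motion01_def filtration01_def\<close>)
  have "integrable M X"
    by (rule integrable_const_bound[of _ C]) (use X Xm in auto)
  from brownian_increment_independent[OF B st X(1) this, of "\<lambda>x. x\<^sup>2"]
  show "expectation (\<lambda>\<omega>. X \<omega> * ((B t \<omega> - B s \<omega>) * (B t \<omega> - B s \<omega>))) = 1 * (t - s) * expectation X"
    using brownian_increment(2,4)[OF B st] by (simp add: power2_eq_square mult.commute)
qed (use B brownian_increment(2)[OF B] brownian_martingale_increment[OF B] in \<open>auto simp: brownian_motion01_def\<close>)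

text \<open>If \<open>W\<close> is still a Brownian motion for a filtration \<open>G\<close> that contains \<open>F\<close> and the whole path of
  \<open>B\<close>, then \<open>X * (B t - B s)\<close> belongs to the past of \<open>W\<close> at time \<open>s\<close>, so multiplying it by
  \<open>W t - W s\<close> gives expectation \<open>0\<close>.\<close>

lemma (in prob_space) brownian_pair_orthogonal:
  assumes B: "brownian_motion01 M F B" and W: "brownian_motion01 M F W" and W': "brownian_motion01 M G W"
    and sub: "\<And>t. t \<in> {0..1} \<Longrightarrow> subalgebra (G t) (F t)"
    and BG: "\<And>s t. s \<in> {0..1} \<Longrightarrow> t \<in> {0..1} \<Longrightarrow> B s \<in> borel_measurable (G t)"
  shows "brownian_pair M F B W 0"
proof
  fix s t :: real and X :: "'a \<Rightarrow> real" and C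
  assume st: "s \<in> {0..1}" "t \<in> {0..1}" "s \<le> t" and X: "X \<in> borel_measurable (F s)" "\<And>\<omega>. \<omega> \<in> space M \<Longrightarrow> \<bar>X \<omega>\<bar> \<le> C"
  interpret BB: brownian_pair M F B B 1 by (rule brownian_pair_same[OF B])
  have "X \<in> borel_measurable (G s)" using sub[OF st(1)] X(1) by (rule measurable_from_subalg)
  then have "(\<lambda>\<omega>. X \<omega> * (B t \<omega> - B s \<omega>)) \<in> borel_measurable (G s)"
    using BG st by (intro borel_measurable_times borel_measurable_diff) auto
  moreover have "integrable M (\<lambda>\<omega>. (X \<omega> * (B t \<omega> - B s \<omega>))\<^sup>2)"
    by (rule BB.square_integrable_bounded_mult[OF BB.measurable_F[OF X(1) st(1)] brownian_increment(1)[OF B st] X(2) brownian_increment(2)[OF B st]])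
  ultimately have "expectation (\<lambda>\<omega>. (X \<omega> * (B t \<omega> - B s \<omega>)) * (W t \<omega> - W s \<omega>)) = 0"
    by (rule brownian_martingale_increment[OF W' st])
  then show "expectation (\<lambda>\<omega>. X \<omega> * ((B t \<omega> - B s \<omega>) * (W t \<omega> - W s \<omega>))) = 0 * (t - s) * expectation X"
    by (simp add: mult.assoc)
qed (use B W brownian_increment(2)[OF B] brownian_increment(2)[OF W] brownian_martingale_increment[OF B] brownian_martingale_increment[OF W] in \<open>auto simp: brownian_motion01_def\<close>)

section \<open>Second moments of a triangular weak solution\<close>

text \<open>The product of the integrands is \<open>K (t - s) * L (t - s) * V s\<close>, in which only \<open>V s\<close> is random;
  by Fubini it may be replaced by its mean.\<close>

lemma (in brownian_pair) volterra_ito_isometry: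
  assumes t: "t \<in> {0..1}"
    and X: "has_ito_integral M F B t (\<lambda>s \<omega>. K (t - s) * sqrt (V s \<omega>)) X"
    and Y: "has_ito_integral M F W t (\<lambda>s \<omega>. L (t - s) * sqrt (V s \<omega>)) Y"
    and nonneg: "\<And>s \<omega>. s \<in> {0..1} \<Longrightarrow> \<omega> \<in> space M \<Longrightarrow> 0 \<le> V s \<omega>"
    and mean: "\<And>s. s \<in> {0..1} \<Longrightarrow> expectation (V s) = b s"
  shows "expectation (\<lambda>\<omega>. X \<omega> * Y \<omega>) = \<rho> * conv (\<lambda>u. K u * L u) b t"
proof -
  interpret sw: brownian_pair M F W B \<rho> by (rule swap)
  interpret P: pair_sigma_finite lborel M
    by (simp add: pair_sigma_finite_def sigma_finite_lborel sigma_finite_measure_axioms)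
  let ?H = "\<lambda>z. case z of (s, \<omega>) \<Rightarrow> indicator {0..t} s * (K (t - s) * sqrt (V s \<omega>))"
  let ?G = "\<lambda>z. case z of (s, \<omega>) \<Rightarrow> indicator {0..t} s * (L (t - s) * sqrt (V s \<omega>))"
  have int: "integrable (lborel \<Otimes>\<^sub>M M) (\<lambda>z. ?H z * ?G z)"
    by (rule integrable_mult_of_squares[OF has_ito_integral_moments(4)[OF t X] sw.has_ito_integral_moments(4)[OF t Y]
       has_ito_integral_moments(5)[OF t X] sw.has_ito_integral_moments(5)[OF t Y]])
  have "(\<integral>\<omega>. ?H (s, \<omega>) * ?G (s, \<omega>) \<partial>M) = indicator {0..t} s *\<^sub>R (K (t - s) * L (t - s) * b s)" for s
  proof (cases "s \<in> {0..t}")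
    case True
    then have s: "s \<in> {0..1}" using t by auto
    have "(\<integral>\<omega>. ?H (s, \<omega>) * ?G (s, \<omega>) \<partial>M) = (\<integral>\<omega>. K (t - s) * L (t - s) * V s \<omega> \<partial>M)"
    proof (rule Bochner_Integration.integral_cong[OF refl])
      fix \<omega> assume "\<omega> \<in> space M"
      then have "sqrt (V s \<omega>) * sqrt (V s \<omega>) = V s \<omega>" using nonneg[OF s] by simp
      then have "K (t - s) * L (t - s) * V s \<omega> = K (t - s) * L (t - s) * (sqrt (V s \<omega>) * sqrt (V s \<omega>))" by simp
      then show "?H (s, \<omega>) * ?G (s, \<omega>) = K (t - s) * L (t - s) * V s \<omega>"
        using True by (simp only: case_prod_conv indicator_simps mult_1_left mult_ac)
    qed
    then show ?thesis using True mean[OF s] by simp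
  qed simp
  then have "(\<integral>z. ?H z * ?G z \<partial>(lborel \<Otimes>\<^sub>M M)) = conv (\<lambda>u. K u * L u) b t"
    using P.integral_fst'[OF int] by (simp add: conv_def set_lebesgue_integral_def)
  with has_ito_integral_isometry[OF t X Y] show ?thesis by simp
qed

text \<open>The means are computed first, for all times, because they enter the isometry as weights.  In the
  products only the integrals against the same Brownian motion survive.\<close>

lemma
  assumes V: "triangular_weak_solution b1 b2 K1 K2 L12 \<nu>1 \<nu>2 \<gamma>12 M F V1 V2 B1 B2"
    and t: "t \<in> {0..1}"
  shows triangular_weak_solution_covariance:
      "covariance M (V1 t) (V2 t) = \<gamma>12 * \<nu>1\<^sup>2 * conv (\<lambda>u. K1 u * L12 u) b1 t"
    and triangular_weak_solution_variance1:
      "prob_space.variance M (V1 t) = \<nu>1\<^sup>2 * conv (\<lambda>u. K1 u * K1 u) b1 t"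
    and triangular_weak_solution_variance2:
      "prob_space.variance M (V2 t) =
         \<nu>2\<^sup>2 * conv (\<lambda>u. K2 u * K2 u) b2 t + (\<gamma>12 * \<nu>1)\<^sup>2 * conv (\<lambda>u. L12 u * L12 u) b1 t"
proof -
  have ps: "prob_space M" and B: "brownian_motion01 M F B1" "brownian_motion01 M F B2"
    and B2': "brownian_motion01 M (enlarged_filtration M F V1 B1) B2"
    using V by (auto simp: triangular_weak_solution_def standard_stochastic_basis_def)
  interpret prob_space M by (rule ps)
  have sub: "subalgebra M (F s)" if "s \<in> {0..1}" for s
    using B that by (simp add: brownian_motion01_def filtration01_def)
  have B1m: "B1 s \<in> borel_measurable M" if "s \<in> {0..1}" for s
    by (rule measurable_from_subalg[OF sub[OF that]]) (use B that in \<open>simp add: brownian_motion01_def\<close>)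
  have VF: "V1 s \<in> borel_measurable (F s)" "V2 s \<in> borel_measurable (F s)"
    and Vnn: "\<omega> \<in> space M \<Longrightarrow> 0 \<le> V1 s \<omega>" "\<omega> \<in> space M \<Longrightarrow> 0 \<le> V2 s \<omega>" if s: "s \<in> {0..1}" for s \<omega>
    using V s by (simp_all add: triangular_weak_solution_def)
  have Vm: "V1 s \<in> borel_measurable M" "V2 s \<in> borel_measurable M" if s: "s \<in> {0..1}" for s
    using measurable_from_subalg[OF sub[OF s]] VF[OF s] by blast+
  interpret p11: brownian_pair M F B1 B1 1 by (rule brownian_pair_same[OF B(1)])
  interpret p22: brownian_pair M F B2 B2 1 by (rule brownian_pair_same[OF B(2)])
  interpret p12: brownian_pair M F B1 B2 0
  proof (rule brownian_pair_orthogonal[OF B B2'])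
    let ?gen = "\<lambda>u. (\<Union>s\<in>{0..1}. sets (vimage_algebra (space M) (V1 s) borel)
                    \<union> sets (vimage_algebra (space M) (B1 s) borel)) \<union> sets (F u)"
    have gen: "?gen u \<subseteq> Pow (space M)" if "u \<in> {0..1}" for u
      using sets.sets_into_space[of _ "F u"] sub[OF that] sets.sets_into_space[of _ "vimage_algebra (space M) _ borel"]
      by (fastforce simp: subalgebra_def)
    then have sets_G: "sets (enlarged_filtration M F V1 B1 u) = sigma_sets (space M) (?gen u)"
      and space_G: "space (enlarged_filtration M F V1 B1 u) = space M" if "u \<in> {0..1}" for u
      using that by (simp_all add: enlarged_filtration_def sets_measure_of space_measure_of)
    show "subalgebra (enlarged_filtration M F V1 B1 u) (F u)" if "u \<in> {0..1}" for u
      unfolding subalgebra_def sets_G[OF that] space_G[OF that] using sub[OF that]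
      by (auto simp: subalgebra_def intro: sigma_sets.Basic)
    fix s u :: real assume s: "s \<in> {0..1}" and u: "u \<in> {0..1}"
    show "B1 s \<in> borel_measurable (enlarged_filtration M F V1 B1 u)"
    proof (rule measurableI)
      fix A :: "real set" assume "A \<in> sets borel"
      then have "B1 s -` A \<inter> space M \<in> sets (vimage_algebra (space M) (B1 s) borel)"
        by (rule in_vimage_algebra)
      then show "B1 s -` A \<inter> space (enlarged_filtration M F V1 B1 u) \<in> sets (enlarged_filtration M F V1 B1 u)"
        unfolding sets_G[OF u] space_G[OF u] using s by (intro sigma_sets.Basic) auto
    qed simp
  qed
  have eq1: "\<exists>I. has_ito_integral M F B1 s (\<lambda>r \<omega>. K1 (s - r) * sqrt (V1 r \<omega>)) I \<and>
        (AE \<omega> in M. V1 s \<omega> = b1 s + \<nu>1 * I \<omega>)" if "s \<in> {0..1}" for s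
    using V that by (auto simp: triangular_weak_solution_def)
  have eq2: "\<exists>I J. has_ito_integral M F B2 s (\<lambda>r \<omega>. K2 (s - r) * sqrt (V2 r \<omega>)) I \<and>
        has_ito_integral M F B1 s (\<lambda>r \<omega>. L12 (s - r) * sqrt (V1 r \<omega>)) J \<and>
        (AE \<omega> in M. V2 s \<omega> = b2 s + \<nu>2 * I \<omega> + \<gamma>12 * \<nu>1 * J \<omega>)" if "s \<in> {0..1}" for s
    using V that by (auto simp: triangular_weak_solution_def)
  have L1: "integrable M X" if "X \<in> borel_measurable M" "integrable M (\<lambda>\<omega>. (X \<omega>)\<^sup>2)" for X :: "_ \<Rightarrow> real"
    using integrable_mult_of_squares[OF that(1) _ that(2), of "\<lambda>_. 1"] by simp
  have mean1: "expectation (V1 s) = b1 s" if s: "s \<in> {0..1}" for s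
  proof -
    obtain I where I: "has_ito_integral M F B1 s (\<lambda>r \<omega>. K1 (s - r) * sqrt (V1 r \<omega>)) I"
      and eq: "AE \<omega> in M. V1 s \<omega> = b1 s + \<nu>1 * I \<omega>" using eq1[OF s] by blast
    note mI = p11.has_ito_integral_moments[OF s I]
    have [measurable]: "I \<in> borel_measurable M" "V1 s \<in> borel_measurable M" using mI Vm s by auto
    have "expectation (V1 s) = expectation (\<lambda>\<omega>. b1 s + \<nu>1 * I \<omega>)"
      by (rule integral_cong_AE[OF _ _ eq]) measurable
    then show ?thesis using L1[OF mI(1,2)] mI(3) by (simp add: prob_space)
  qed
  have mean2: "expectation (V2 s) = b2 s" if s: "s \<in> {0..1}" for s
  proof -
    obtain I J where I: "has_ito_integral M F B2 s (\<lambda>r \<omega>. K2 (s - r) * sqrt (V2 r \<omega>)) I"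
      and J: "has_ito_integral M F B1 s (\<lambda>r \<omega>. L12 (s - r) * sqrt (V1 r \<omega>)) J"
      and eq: "AE \<omega> in M. V2 s \<omega> = b2 s + \<nu>2 * I \<omega> + \<gamma>12 * \<nu>1 * J \<omega>" using eq2[OF s] by blast
    note mI = p22.has_ito_integral_moments[OF s I] and mJ = p11.has_ito_integral_moments[OF s J]
    have [measurable]: "I \<in> borel_measurable M" "J \<in> borel_measurable M" "V2 s \<in> borel_measurable M" using mI mJ Vm s by auto
    have "expectation (V2 s) = expectation (\<lambda>\<omega>. b2 s + \<nu>2 * I \<omega> + \<gamma>12 * \<nu>1 * J \<omega>)"
      by (rule integral_cong_AE[OF _ _ eq]) measurable
    then show ?thesis using L1[OF mI(1,2)] L1[OF mJ(1,2)] mI(3) mJ(3) by (simp add: prob_space)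
  qed
  obtain I where I: "has_ito_integral M F B1 t (\<lambda>r \<omega>. K1 (t - r) * sqrt (V1 r \<omega>)) I"
    and eI: "AE \<omega> in M. V1 t \<omega> = b1 t + \<nu>1 * I \<omega>" using eq1[OF t] by blast
  obtain I' J where I': "has_ito_integral M F B2 t (\<lambda>r \<omega>. K2 (t - r) * sqrt (V2 r \<omega>)) I'"
    and J: "has_ito_integral M F B1 t (\<lambda>r \<omega>. L12 (t - r) * sqrt (V1 r \<omega>)) J"
    and eI': "AE \<omega> in M. V2 t \<omega> = b2 t + \<nu>2 * I' \<omega> + \<gamma>12 * \<nu>1 * J \<omega>" using eq2[OF t] by blast
  note mI = p11.has_ito_integral_moments[OF t I] and mI' = p22.has_ito_integral_moments[OF t I']
    and mJ = p11.has_ito_integral_moments[OF t J]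
  have [measurable]: "I \<in> borel_measurable M" "I' \<in> borel_measurable M" "J \<in> borel_measurable M"
    "V1 t \<in> borel_measurable M" "V2 t \<in> borel_measurable M"
    using mI mI' mJ Vm t by auto
  have sq: "integrable M (\<lambda>\<omega>. X \<omega> * Y \<omega>)" if "X \<in> {I, I', J}" "Y \<in> {I, I', J}" for X Y
    using that mI(1,2) mI'(1,2) mJ(1,2) by (auto intro!: integrable_mult_of_squares)
  have II: "expectation (\<lambda>\<omega>. I \<omega> * I \<omega>) = conv (\<lambda>u. K1 u * K1 u) b1 t"
    using p11.volterra_ito_isometry[OF t I I Vnn(1) mean1] by simp
  have IJ: "expectation (\<lambda>\<omega>. I \<omega> * J \<omega>) = conv (\<lambda>u. K1 u * L12 u) b1 t"
    using p11.volterra_ito_isometry[OF t I J Vnn(1) mean1] by simp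
  have JJ: "expectation (\<lambda>\<omega>. J \<omega> * J \<omega>) = conv (\<lambda>u. L12 u * L12 u) b1 t"
    using p11.volterra_ito_isometry[OF t J J Vnn(1) mean1] by simp
  have I'I': "expectation (\<lambda>\<omega>. I' \<omega> * I' \<omega>) = conv (\<lambda>u. K2 u * K2 u) b2 t"
    using p22.volterra_ito_isometry[OF t I' I' Vnn(2) mean2] by simp
  have II': "expectation (\<lambda>\<omega>. I \<omega> * I' \<omega>) = 0" and JI': "expectation (\<lambda>\<omega>. J \<omega> * I' \<omega>) = 0"
    using p12.has_ito_integral_isometry[OF t I I'] p12.has_ito_integral_isometry[OF t J I'] by simp_all
  have "covariance M (V1 t) (V2 t) = expectation (\<lambda>\<omega>. \<nu>1 * \<nu>2 * (I \<omega> * I' \<omega>) + \<gamma>12 * \<nu>1\<^sup>2 * (I \<omega> * J \<omega>))"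
    unfolding covariance_def mean1[OF t] mean2[OF t]
  proof (rule integral_cong_AE)
    show "AE \<omega> in M. (V1 t \<omega> - b1 t) * (V2 t \<omega> - b2 t) = \<nu>1 * \<nu>2 * (I \<omega> * I' \<omega>) + \<gamma>12 * \<nu>1\<^sup>2 * (I \<omega> * J \<omega>)"
      using eI eI' by eventually_elim (simp add: algebra_simps power2_eq_square)
  qed measurable
  then show "covariance M (V1 t) (V2 t) = \<gamma>12 * \<nu>1\<^sup>2 * conv (\<lambda>u. K1 u * L12 u) b1 t"
    using sq by (simp add: II' IJ)
  have "variance (V1 t) = expectation (\<lambda>\<omega>. \<nu>1\<^sup>2 * (I \<omega> * I \<omega>))"
    unfolding mean1[OF t]
  proof (rule integral_cong_AE)
    show "AE \<omega> in M. (V1 t \<omega> - b1 t)\<^sup>2 = \<nu>1\<^sup>2 * (I \<omega> * I \<omega>)"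
      using eI by eventually_elim (simp add: power2_eq_square)
  qed measurable
  then show "variance (V1 t) = \<nu>1\<^sup>2 * conv (\<lambda>u. K1 u * K1 u) b1 t"
    by (simp add: II)
  have "variance (V2 t) = expectation (\<lambda>\<omega>. \<nu>2\<^sup>2 * (I' \<omega> * I' \<omega>) + 2 * \<nu>2 * \<gamma>12 * \<nu>1 * (J \<omega> * I' \<omega>) + (\<gamma>12 * \<nu>1)\<^sup>2 * (J \<omega> * J \<omega>))"
    unfolding mean2[OF t]
  proof (rule integral_cong_AE)
    show "AE \<omega> in M. (V2 t \<omega> - b2 t)\<^sup>2 = \<nu>2\<^sup>2 * (I' \<omega> * I' \<omega>) + 2 * \<nu>2 * \<gamma>12 * \<nu>1 * (J \<omega> * I' \<omega>) + (\<gamma>12 * \<nu>1)\<^sup>2 * (J \<omega> * J \<omega>)"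
      using eI' by eventually_elim (simp add: algebra_simps power2_eq_square)
  qed measurable
  then show "variance (V2 t) = \<nu>2\<^sup>2 * conv (\<lambda>u. K2 u * K2 u) b2 t + (\<gamma>12 * \<nu>1)\<^sup>2 * conv (\<lambda>u. L12 u * L12 u) b1 t"
    using sq by (simp add: I'I' JI' JJ)
qed

section \<open>Asymptotics of the functional correlation\<close>

theorem corollary3p7:
  fixes \<phi>1 \<phi>2 \<psi>12 a1 a2 \<mu>1 \<mu>2 b12 :: "real \<Rightarrow> real"
    and \<phi>12 :: "real \<Rightarrow> real \<Rightarrow> real"
    and \<alpha>1 \<alpha>2 \<delta>1 \<delta>2 lam1 lam2 m1 m2 binf :: real
    and K1 K2 :: "real \<Rightarrow> real"
    and M :: "'a measure" and F :: "real \<Rightarrow> 'a measure"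
    and V1 V2 B1 B2 :: "real \<Rightarrow> 'a \<Rightarrow> real"
    and d1 d2 \<nu>1 \<nu>2 \<gamma>12 \<kappa>1 \<kappa>2 \<beta>1 \<beta>2 C :: real
    and L12 b1 b2 :: "real \<Rightarrow> real"
  defines "d1 \<equiv> \<delta>1 / lam1" and "d2 \<equiv> \<delta>2 / lam2"
    and "\<nu>1 \<equiv> (m1 * lam1) powr (- 1 / 2)" and "\<nu>2 \<equiv> (m2 * lam2) powr (- 1 / 2)"
    and "\<gamma>12 \<equiv> m1 / (m2 * lam1)"
    and "L12 \<equiv> \<lambda>t. binf * norm_L1 \<psi>12 * conv K1 K2 t"
    and "b1 \<equiv> \<lambda>t. LINT w:{0..t}|lborel. K1 w"
    and "b2 \<equiv> \<lambda>t. (LINT w:{0..t}|lborel. K2 w) + \<gamma>12 * (LINT w:{0..t}|lborel. L12 w)"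
    and "\<kappa>1 \<equiv> inverse (d1 * Gamma \<alpha>1)" and "\<kappa>2 \<equiv> inverse (d2 * Gamma \<alpha>2)"
    and "\<beta>1 \<equiv> \<kappa>1 / \<alpha>1" and "\<beta>2 \<equiv> \<kappa>2 / \<alpha>2"
    and "C \<equiv> (\<gamma>12 * \<nu>1\<^sup>2 * binf * norm_L1 \<psi>12 * \<kappa>1\<^sup>2 * \<kappa>2 * \<beta>1
                * Beta \<alpha>1 \<alpha>2 * Beta (2 * \<alpha>1 + \<alpha>2 - 1) (\<alpha>1 + 1))
             / sqrt (\<nu>1\<^sup>2 * \<kappa>1\<^sup>2 * \<beta>1 * Beta (2 * \<alpha>1 - 1) (\<alpha>1 + 1)
                     * (\<nu>2\<^sup>2 * \<kappa>2\<^sup>2 * \<beta>2 * Beta (2 * \<alpha>2 - 1) (\<alpha>2 + 1)))"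
  assumes A1: "assm_A1 \<phi>1 \<alpha>1 \<delta>1" "assm_A1 \<phi>2 \<alpha>2 \<delta>2" "\<alpha>1 < \<alpha>2"
    and A2: "assm_A2 a1 \<alpha>1 lam1" "assm_A2 a2 \<alpha>2 lam2"
    and A3: "assm_A3 \<psi>12 b12 \<phi>12 \<alpha>1 \<alpha>2 binf"
    and A4: "assm_A4 \<mu>1 \<alpha>1 m1" "assm_A4 \<mu>2 \<alpha>2 m2"
    and A5: "lam1 powr (1 / \<alpha>1) = lam2 powr (1 / \<alpha>2)"
    and K: "mittag_leffler_kernel \<alpha>1 d1 K1" "mittag_leffler_kernel \<alpha>2 d2 K2"
    and V: "triangular_weak_solution b1 b2 K1 K2 L12 \<nu>1 \<nu>2 \<gamma>12 M F V1 V2 B1 B2"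
  shows "functional_correlation M V1 V2
           \<sim>[at_right 0] (\<lambda>t. C * t powr ((3 * \<alpha>1 - \<alpha>2) / 2))"
proof -
  have \<alpha>: "1 / 2 < \<alpha>1" "\<alpha>1 < 1" "1 / 2 < \<alpha>2" "\<alpha>2 < 1" and \<delta>: "\<delta>1 > 0" "\<delta>2 > 0"
    using A1 by (auto simp: assm_A1_def)
  have lam: "lam1 > 0" "lam2 > 0" using A2 by (auto simp: assm_A2_def)
  have m: "m1 > 0" "m2 > 0" using A4 by (auto simp: assm_A4_def)
  define c where "c = binf * norm_L1 \<psi>12"
  have d: "d1 > 0" "d2 > 0" using \<delta> lam by (simp_all add: d1_def d2_def)
  have \<kappa>: "\<kappa>1 > 0" "\<kappa>2 > 0" using d \<alpha> by (auto simp: \<kappa>1_def \<kappa>2_def intro!: Gamma_real_pos mult_pos_pos)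
  have \<beta>: "\<beta>1 > 0" "\<beta>2 > 0" using \<kappa> \<alpha> by (simp_all add: \<beta>1_def \<beta>2_def)
  have \<nu>: "\<nu>1 > 0" "\<nu>2 > 0" using m lam by (simp_all add: \<nu>1_def \<nu>2_def)
  have \<gamma>: "\<gamma>12 > 0" using m lam by (simp add: \<gamma>12_def)
  have Beta_pos: "Beta p q > 0" if "p > 0" "q > 0" for p q :: real
    using that by (simp add: Beta_def)

  have K1: "ae_power_near_0 K1 \<kappa>1 \<alpha>1" and K2: "ae_power_near_0 K2 \<kappa>2 \<alpha>2"
    unfolding \<kappa>1_def \<kappa>2_def using \<alpha> by (intro mittag_leffler_kernel_near_0[OF K(1) d(1)] mittag_leffler_kernel_near_0[OF K(2) d(2)]; simp)+
  have L: "ae_power_near_0 L12 (c * (\<kappa>1 * \<kappa>2 * Beta \<alpha>1 \<alpha>2)) (\<alpha>1 + \<alpha>2)"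
    unfolding L12_def c_def using \<alpha> by (intro ae_power_near_0_cmult ae_power_near_0_conv K1 K2) auto
  have b1_eq: "b1 = conv (\<lambda>_. 1) K1" and b2_eq: "b2 = (\<lambda>t. conv (\<lambda>_. 1) K2 t + \<gamma>12 * conv (\<lambda>_. 1) L12 t)"
    by (simp_all add: b1_def b2_def conv_one_eq fun_eq_iff)
  (* The means are convolutions with the constant 1, a power with p = 1, and Beta 1 p = 1 / p. *)
  have b1: "ae_power_near_0 b1 \<beta>1 (\<alpha>1 + 1)"
    using ae_power_near_0_conv[OF ae_power_near_0_one K1] \<alpha> by (simp add: b1_eq \<beta>1_def Beta_1_left add.commute)
  have iK2: "ae_power_near_0 (conv (\<lambda>_. 1) K2) \<beta>2 (\<alpha>2 + 1)"
    using ae_power_near_0_conv[OF ae_power_near_0_one K2] \<alpha> by (simp add: \<beta>2_def Beta_1_left add.commute)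
  have b2: "ae_power_near_0 b2 \<beta>2 (\<alpha>2 + 1)"
  proof (rule ae_power_near_0_of_limit)
    have m: "set_borel_measurable lborel {0..} (\<lambda>_::real. 1::real)" "set_borel_measurable lborel {0..} K2"
      "set_borel_measurable lborel {0..} L12"
      using K2 L ae_power_near_0_one by (auto simp: ae_power_near_0_def)
    have [measurable]: "conv (\<lambda>_. 1) K2 \<in> borel_measurable borel" "conv (\<lambda>_. 1) L12 \<in> borel_measurable borel"
      by (intro conv_measurable m)+
    show "set_borel_measurable lborel {0..} b2"
      unfolding b2_eq set_borel_measurable_def by measurable
    have "((\<lambda>t. conv (\<lambda>_. 1) K2 t / t powr \<alpha>2) \<longlongrightarrow> \<beta>2) (at_right 0)"
      using conv_power_limit[OF ae_power_near_0_one K2] \<alpha> by (simp add: \<beta>2_def Beta_1_left)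
    moreover have "((\<lambda>t. \<gamma>12 * (conv (\<lambda>_. 1) L12 t / t powr (\<alpha>1 + \<alpha>2)))
        \<longlongrightarrow> \<gamma>12 * (1 * (c * (\<kappa>1 * \<kappa>2 * Beta \<alpha>1 \<alpha>2)) * Beta 1 (\<alpha>1 + \<alpha>2))) (at_right 0)"
      using conv_power_limit[OF ae_power_near_0_one L] \<alpha> by (intro tendsto_mult_left) simp
    ultimately show "((\<lambda>t. b2 t / t powr (\<alpha>2 + 1 - 1)) \<longlongrightarrow> \<beta>2) (at_right 0)"
      unfolding b2_eq using tendsto_add_higher_power[of "conv (\<lambda>_. 1) K2" \<alpha>2 \<beta>2 "\<lambda>t. \<gamma>12 * conv (\<lambda>_. 1) L12 t" "\<alpha>1 + \<alpha>2"] \<alpha>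
      by simp
  qed

  define cv where "cv = (\<lambda>t. covariance M (V1 t) (V2 t))"
  define v1 where "v1 = (\<lambda>t. prob_space.variance M (V1 t))"
  define v2 where "v2 = (\<lambda>t. prob_space.variance M (V2 t))"
  define c1 where "c1 = \<nu>1\<^sup>2 * \<kappa>1\<^sup>2 * \<beta>1 * Beta (2 * \<alpha>1 - 1) (\<alpha>1 + 1)"
  define c2 where "c2 = \<nu>2\<^sup>2 * \<kappa>2\<^sup>2 * \<beta>2 * Beta (2 * \<alpha>2 - 1) (\<alpha>2 + 1)"
  define c12 where "c12 = \<gamma>12 * \<nu>1\<^sup>2 * (\<kappa>1 * (c * (\<kappa>1 * \<kappa>2 * Beta \<alpha>1 \<alpha>2)) * \<beta>1 * Beta (2 * \<alpha>1 + \<alpha>2 - 1) (\<alpha>1 + 1))"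
  have c_pos: "c1 > 0" "c2 > 0"
    unfolding c1_def c2_def using \<nu> \<kappa> \<beta> \<alpha> by (intro mult_pos_pos Beta_pos zero_less_power; simp)+
  have C_eq: "C = c12 / sqrt (c1 * c2)"
    unfolding C_def c12_def c1_def c2_def c_def by (simp add: power2_eq_square mult_ac)
  have small: "\<forall>\<^sub>F t in at_right (0::real). 0 < t \<and> t < 1"
    using eventually_at_right_less[of 0] eventually_at_right_field[of "\<lambda>t. t < 1" 0]
    by (auto intro!: eventually_conj exI[of _ 1])
  have moments: "cv t = \<gamma>12 * \<nu>1\<^sup>2 * conv (\<lambda>u. K1 u * L12 u) b1 t"
    "v1 t = \<nu>1\<^sup>2 * conv (\<lambda>u. K1 u * K1 u) b1 t"
    "v2 t = \<nu>2\<^sup>2 * conv (\<lambda>u. K2 u * K2 u) b2 t + (\<gamma>12 * \<nu>1)\<^sup>2 * conv (\<lambda>u. L12 u * L12 u) b1 t"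
    if "0 < t \<and> t < 1" for t
    unfolding cv_def v1_def v2_def
    using that by (intro triangular_weak_solution_covariance[OF V] triangular_weak_solution_variance1[OF V]
      triangular_weak_solution_variance2[OF V]; simp)+

  have lim_cv: "((\<lambda>t. cv t / t powr (3 * \<alpha>1 + \<alpha>2 - 1)) \<longlongrightarrow> c12) (at_right 0)"
  proof -
    have "((\<lambda>t. conv (\<lambda>u. K1 u * L12 u) b1 t / t powr (\<alpha>1 + (\<alpha>1 + \<alpha>2) - 1 + (\<alpha>1 + 1) - 1))
       \<longlongrightarrow> \<kappa>1 * (c * (\<kappa>1 * \<kappa>2 * Beta \<alpha>1 \<alpha>2)) * \<beta>1 * Beta (\<alpha>1 + (\<alpha>1 + \<alpha>2) - 1) (\<alpha>1 + 1)) (at_right 0)"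
      using \<alpha> by (intro conv_power_limit ae_power_near_0_mult K1 L b1) auto
    also have "\<alpha>1 + (\<alpha>1 + \<alpha>2) - 1 + (\<alpha>1 + 1) - 1 = 3 * \<alpha>1 + \<alpha>2 - 1" by simp
    also have "\<alpha>1 + (\<alpha>1 + \<alpha>2) - 1 = 2 * \<alpha>1 + \<alpha>2 - 1" by simp
    finally have "((\<lambda>t. \<gamma>12 * \<nu>1\<^sup>2 * (conv (\<lambda>u. K1 u * L12 u) b1 t / t powr (3 * \<alpha>1 + \<alpha>2 - 1))) \<longlongrightarrow> c12) (at_right 0)"
      unfolding c12_def by (rule tendsto_mult_left)
    moreover have "\<forall>\<^sub>F t in at_right 0. \<gamma>12 * \<nu>1\<^sup>2 * (conv (\<lambda>u. K1 u * L12 u) b1 t / t powr (3 * \<alpha>1 + \<alpha>2 - 1)) = cv t / t powr (3 * \<alpha>1 + \<alpha>2 - 1)"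
      using small by eventually_elim (simp add: moments)
    ultimately show ?thesis by (rule Lim_transform_eventually)
  qed
  have lim_v1: "((\<lambda>t. v1 t / t powr (3 * \<alpha>1 - 1)) \<longlongrightarrow> c1) (at_right 0)"
  proof -
    have "((\<lambda>t. conv (\<lambda>u. K1 u * K1 u) b1 t / t powr (\<alpha>1 + \<alpha>1 - 1 + (\<alpha>1 + 1) - 1))
       \<longlongrightarrow> \<kappa>1 * \<kappa>1 * \<beta>1 * Beta (\<alpha>1 + \<alpha>1 - 1) (\<alpha>1 + 1)) (at_right 0)"
      using \<alpha> by (intro conv_power_limit ae_power_near_0_mult K1 b1) auto
    also have "\<alpha>1 + \<alpha>1 - 1 + (\<alpha>1 + 1) - 1 = 3 * \<alpha>1 - 1" by simp
    also have "\<kappa>1 * \<kappa>1 * \<beta>1 * Beta (\<alpha>1 + \<alpha>1 - 1) (\<alpha>1 + 1) = \<kappa>1\<^sup>2 * \<beta>1 * Beta (2 * \<alpha>1 - 1) (\<alpha>1 + 1)"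
      by (simp add: power2_eq_square)
    finally have "((\<lambda>t. \<nu>1\<^sup>2 * (conv (\<lambda>u. K1 u * K1 u) b1 t / t powr (3 * \<alpha>1 - 1))) \<longlongrightarrow> c1) (at_right 0)"
      unfolding c1_def mult.assoc by (rule tendsto_mult_left)
    moreover have "\<forall>\<^sub>F t in at_right 0. \<nu>1\<^sup>2 * (conv (\<lambda>u. K1 u * K1 u) b1 t / t powr (3 * \<alpha>1 - 1)) = v1 t / t powr (3 * \<alpha>1 - 1)"
      using small by eventually_elim (simp add: moments)
    ultimately show ?thesis by (rule Lim_transform_eventually)
  qed
  have lim_v2: "((\<lambda>t. v2 t / t powr (3 * \<alpha>2 - 1)) \<longlongrightarrow> c2) (at_right 0)"
  proof -
    have "((\<lambda>t. conv (\<lambda>u. K2 u * K2 u) b2 t / t powr (\<alpha>2 + \<alpha>2 - 1 + (\<alpha>2 + 1) - 1))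
       \<longlongrightarrow> \<kappa>2 * \<kappa>2 * \<beta>2 * Beta (\<alpha>2 + \<alpha>2 - 1) (\<alpha>2 + 1)) (at_right 0)"
      using \<alpha> by (intro conv_power_limit ae_power_near_0_mult K2 b2) auto
    also have "\<alpha>2 + \<alpha>2 - 1 + (\<alpha>2 + 1) - 1 = 3 * \<alpha>2 - 1" by simp
    also have "\<kappa>2 * \<kappa>2 * \<beta>2 * Beta (\<alpha>2 + \<alpha>2 - 1) (\<alpha>2 + 1) = \<kappa>2\<^sup>2 * \<beta>2 * Beta (2 * \<alpha>2 - 1) (\<alpha>2 + 1)"
      by (simp add: power2_eq_square)
    finally have 1: "((\<lambda>t. \<nu>2\<^sup>2 * (conv (\<lambda>u. K2 u * K2 u) b2 t / t powr (3 * \<alpha>2 - 1))) \<longlongrightarrow> c2) (at_right 0)"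
      unfolding c2_def mult.assoc by (rule tendsto_mult_left)
    have "((\<lambda>t. conv (\<lambda>u. L12 u * L12 u) b1 t / t powr (\<alpha>1 + \<alpha>2 + (\<alpha>1 + \<alpha>2) - 1 + (\<alpha>1 + 1) - 1))
       \<longlongrightarrow> c * (\<kappa>1 * \<kappa>2 * Beta \<alpha>1 \<alpha>2) * (c * (\<kappa>1 * \<kappa>2 * Beta \<alpha>1 \<alpha>2)) * \<beta>1
             * Beta (\<alpha>1 + \<alpha>2 + (\<alpha>1 + \<alpha>2) - 1) (\<alpha>1 + 1)) (at_right 0)"
      using \<alpha> by (intro conv_power_limit ae_power_near_0_mult L b1) auto
    from tendsto_mult_left[OF this, of "(\<gamma>12 * \<nu>1)\<^sup>2"]
    have "((\<lambda>t. (\<nu>2\<^sup>2 * conv (\<lambda>u. K2 u * K2 u) b2 t + (\<gamma>12 * \<nu>1)\<^sup>2 * conv (\<lambda>u. L12 u * L12 u) b1 t) / t powr (3 * \<alpha>2 - 1)) \<longlongrightarrow> c2) (at_right 0)"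
      using 1 \<alpha> by (intro tendsto_add_higher_power[where q = "\<alpha>1 + \<alpha>2 + (\<alpha>1 + \<alpha>2) - 1 + (\<alpha>1 + 1) - 1"]) auto
    moreover have "\<forall>\<^sub>F t in at_right 0. (\<nu>2\<^sup>2 * conv (\<lambda>u. K2 u * K2 u) b2 t + (\<gamma>12 * \<nu>1)\<^sup>2 * conv (\<lambda>u. L12 u * L12 u) b1 t) / t powr (3 * \<alpha>2 - 1) = v2 t / t powr (3 * \<alpha>2 - 1)"
      using small by eventually_elim (simp add: moments)
    ultimately show ?thesis by (rule Lim_transform_eventually)
  qed

  have corr: "functional_correlation M V1 V2 = (\<lambda>t. cv t / sqrt (v1 t * v2 t))"
    by (simp add: functional_correlation_def cv_def v1_def v2_def fun_eq_iff)
  have lim: "((\<lambda>t. functional_correlation M V1 V2 t / t powr ((3 * \<alpha>1 - \<alpha>2) / 2)) \<longlongrightarrow> C) (at_right 0)"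
  proof -
    have "((\<lambda>t. cv t / t powr (3 * \<alpha>1 + \<alpha>2 - 1) / sqrt (v1 t / t powr (3 * \<alpha>1 - 1) * (v2 t / t powr (3 * \<alpha>2 - 1)))) \<longlongrightarrow> C) (at_right 0)"
      unfolding C_eq using c_pos by (intro tendsto_divide tendsto_real_sqrt tendsto_mult lim_cv lim_v1 lim_v2) auto
    moreover have "\<forall>\<^sub>F t in at_right 0. cv t / t powr (3 * \<alpha>1 + \<alpha>2 - 1) / sqrt (v1 t / t powr (3 * \<alpha>1 - 1) * (v2 t / t powr (3 * \<alpha>2 - 1)))
        = functional_correlation M V1 V2 t / t powr ((3 * \<alpha>1 - \<alpha>2) / 2)"
      using small
    proof eventually_elim
      case (elim t)
      let ?e = "(3 * \<alpha>1 + 3 * \<alpha>2 - 2) / 2"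
      have "t powr (3 * \<alpha>1 - 1) * t powr (3 * \<alpha>2 - 1) = (t powr ?e)\<^sup>2"
        by (simp add: power2_eq_square powr_add[symmetric])
      then have "sqrt (v1 t / t powr (3 * \<alpha>1 - 1) * (v2 t / t powr (3 * \<alpha>2 - 1))) = sqrt (v1 t * v2 t) / t powr ?e"
        by (simp add: real_sqrt_divide)
      moreover have "t powr (3 * \<alpha>1 + \<alpha>2 - 1) = t powr ((3 * \<alpha>1 - \<alpha>2) / 2) * t powr ?e"
        unfolding powr_add[symmetric] by (rule arg_cong[of _ _ "\<lambda>e. t powr e"]) (simp add: field_simps)
      ultimately show ?case using elim by (simp add: corr)
    qed
    ultimately show ?thesis by (rule Lim_transform_eventually)
  qed
  (* If \<psi>12 vanishes almost everywhere then C = 0, and asymptotic equivalence to 0 means equality to 0 near the origin. *)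
  show ?thesis
  proof (cases "c = 0")
    case False
    have "C \<noteq> 0"
      unfolding C_eq c12_def using False \<gamma> \<nu> \<kappa> \<beta> c_pos \<alpha> Beta_pos[of \<alpha>1 \<alpha>2] Beta_pos[of "2 * \<alpha>1 + \<alpha>2 - 1" "\<alpha>1 + 1"] by simp
    with lim show ?thesis by (intro asymp_equivI'_const)
  next
    case True
    moreover have "L12 = (\<lambda>t. c * conv K1 K2 t)" by (simp add: L12_def c_def)
    ultimately have "L12 = (\<lambda>_. 0)" by simp
    then have conv_0: "conv (\<lambda>u. K1 u * L12 u) b1 = (\<lambda>_. 0)"
      by (simp add: conv_def[abs_def] set_lebesgue_integral_def)
    have "\<forall>\<^sub>F t in at_right 0. functional_correlation M V1 V2 t = C * t powr ((3 * \<alpha>1 - \<alpha>2) / 2)"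
      using small by eventually_elim (simp add: corr moments conv_0 C_eq c12_def True)
    then show ?thesis by (rule asymp_equiv_refl_ev)
  qed
qed

end
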